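(* Let $n,k$ be positive integers with $1\leq k\leq n-1$, let $G\in\mathcal{V}_n^k$ and let $\alpha\geq 1$ be real. Then $$S_\alpha(G)\leq b_\alpha(n,k),$$ where $$b_\alpha(n,k)=k(n-2)^\alpha+(n-k-2)(n-3)^\alpha+\left[n-2+\tfrac{k}{2}+\tfrac{1}{2}\sqrt{(k-2n)^2+16(k-n+1)}\right]^\alpha+\left[n-2+\tfrac{k}{2}-\tfrac{1}{2}\sqrt{(k-2n)^2+16(k-n+1)}\right]^\alpha.$$ Equality holds if and only if $G=K_k\vee(K_1\cup K_{n-k-1})$.
   Context: For a simple graph $G$ on $n$ vertices with adjacency matrix $A(G)$ and diagonal degree matrix $D(G)$, the signless Laplacian matrix is $Q(G)=D(G)+A(G)$; it is symmetric positive semidefinite with eigenvalues $q_1(G)\ge\cdots\ge q_n(G)\ge 0$. For a non-zero real $\alpha$, $S_\alpha(G)=\sum_{i=1}^{h} q_i(G)^\alpha$, where $h$ is the number of non-zero eigenvalues of $Q(G)$ (counted with multiplicity). The vertex connectivity $\kappa(G)$ is the minimum number of vertices whose deletion disconnects $G$, with the convention $\kappa(K_n)=n-1$. $\mathcal{F}_n$ is the family of simple connected graphs on $n$ vertices, and $\mathcal{V}_n^k=\{G\in\mathcal{F}_n : \kappa(G)\le k\}$. $G\vee H$ is the join (disjoint union plus all edges between $G$ and $H$), $\cup$ is disjoint union, $K_m$ is the complete graph on $m$ vertices, and $K_0$ is the empty graph (so for $k=n-1$ the graph $K_k\vee(K_1\cup K_{n-k-1})$ is $K_n$). When $k=n-1$,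 the second and fourth terms of $b_\alpha(n,k)$ are $-(n-3)^\alpha$ and $(n-3)^\alpha$ and are understood to cancel (relevant only for $n=2$, where the base is negative). Equality of graphs means isomorphism. *)

theory Defs
  imports
    Complex_Main
    "HOL-Computational_Algebra.Polynomial"
    "Graph_Theory.Digraph_Isomorphism"
    "Graph_Theory.Kuratowski"
    "Jordan_Normal_Form.Char_Poly"
begin

text \<open>
  A finite simple graph is a \<^const>\<open>pair_graph\<close>: a finite vertex set together with a symmetric
  irreflexive set of arcs, each edge being represented by its two opposite arcs.
\<close>

definition complete_graph :: "nat \<Rightarrow> nat pair_pre_digraph" where
  "complete_graph m = \<lparr> pverts = {0..<m}, parcs = {(u, v). u < m \<and> v < m \<and> u \<noteq> v} \<rparr>"

definition disjoint_union ::
    "'a pair_pre_digraph \<Rightarrow> 'b pair_pre_digraph \<Rightarrow> ('a + 'b) pair_pre_digraph" where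
  "disjoint_union G H =
     \<lparr> pverts = pverts G <+> pverts H,
       parcs = map_prod Inl Inl ` parcs G \<union> map_prod Inr Inr ` parcs H \<rparr>"

definition graph_join ::
    "'a pair_pre_digraph \<Rightarrow> 'b pair_pre_digraph \<Rightarrow> ('a + 'b) pair_pre_digraph" where
  "graph_join G H =
     \<lparr> pverts = pverts G <+> pverts H,
       parcs = parcs (disjoint_union G H)
         \<union> Inl ` pverts G \<times> Inr ` pverts H
         \<union> Inr ` pverts H \<times> Inl ` pverts G \<rparr>"

definition extremal_graph :: "nat \<Rightarrow> nat \<Rightarrow> (nat + nat + nat) pair_pre_digraph" where
  "extremal_graph n k =
     graph_join (complete_graph k)
       (disjoint_union (complete_graph 1) (complete_graph (n - k - 1)))"

definition isomorphic :: "'a pair_pre_digraph \<Rightarrow> 'b pair_pre_digraph \<Rightarrow> bool" where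
  "isomorphic G H \<longleftrightarrow> digraph_iso (with_proj G) (with_proj H)"


text \<open>
  \<^const>\<open>Digraph_Component.connected\<close> fails for the null graph, hence the requirement that at least one vertex
  is left after the deletion.
\<close>

definition disconnecting_set :: "'a pair_pre_digraph \<Rightarrow> 'a set \<Rightarrow> bool" where
  "disconnecting_set G S \<longleftrightarrow>
     S \<subseteq> pverts G \<and> pverts G - S \<noteq> {} \<and>
     \<not> Digraph_Component.connected (with_proj G \<restriction> (pverts G - S))"

definition vertex_connectivity :: "'a pair_pre_digraph \<Rightarrow> nat" where
  "vertex_connectivity G =
     (if complete_digraph (card (pverts G)) (with_proj G) then card (pverts G) - 1
      else (LEAST m. \<exists>S. disconnecting_set G S \<and> card S = m))"

definition connected_graphs :: "nat \<Rightarrow> 'a pair_pre_digraph set" where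
  "connected_graphs n =
     {G. pair_graph G \<and> Digraph_Component.connected (with_proj G) \<and> card (pverts G) = n}"

definition connectivity_at_most :: "nat \<Rightarrow> nat \<Rightarrow> 'a pair_pre_digraph set" where
  "connectivity_at_most n k = {G \<in> connected_graphs n. vertex_connectivity G \<le> k}"


text \<open>
  The matrices of a graph are indexed along an arbitrary enumeration of its vertices. Another
  enumeration conjugates them by a permutation matrix, so the spectrum does not depend on the choice.
\<close>

definition vertex_list :: "'a pair_pre_digraph \<Rightarrow> 'a list" where
  "vertex_list G = (SOME vs. distinct vs \<and> set vs = pverts G)"

definition adjacency_matrix :: "'a pair_pre_digraph \<Rightarrow> real mat" where
  "adjacency_matrix G =
     mat (card (pverts G)) (card (pverts G))
       (\<lambda>(i, j). if (vertex_list G ! i, vertex_list G ! j) \<in> parcs G then 1 else 0)"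

definition degree_matrix :: "'a pair_pre_digraph \<Rightarrow> real mat" where
  "degree_matrix G =
     mat_diag (card (pverts G)) (\<lambda>i. real (out_degree (with_proj G) (vertex_list G ! i)))"

definition signless_laplacian :: "'a pair_pre_digraph \<Rightarrow> real mat" where
  "signless_laplacian G = degree_matrix G + adjacency_matrix G"

text \<open>
  The multiset of real roots of the characteristic polynomial is the whole spectrum with
  multiplicities, since the signless Laplacian is real symmetric.
\<close>

definition Q_spectrum :: "'a pair_pre_digraph \<Rightarrow> real multiset" where
  "Q_spectrum G = proots (char_poly (signless_laplacian G))"

definition S_sum :: "real \<Rightarrow> 'a pair_pre_digraph \<Rightarrow> real" where
  "S_sum \<alpha> G = (\<Sum>q \<in># filter_mset (\<lambda>q. q \<noteq> 0) (Q_spectrum G). q powr \<alpha>)"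

definition b_bound :: "real \<Rightarrow> nat \<Rightarrow> nat \<Rightarrow> real" where
  "b_bound \<alpha> n k =
     real k * (real n - 2) powr \<alpha>
     + (real n - real k - 2) * (real n - 3) powr \<alpha>
     + (real n - 2 + real k / 2
         + 1/2 * sqrt ((real k - 2 * real n)^2 + 16 * (real k - real n + 1))) powr \<alpha>
     + (real n - 2 + real k / 2
         - 1/2 * sqrt ((real k - 2 * real n)^2 + 16 * (real k - real n + 1))) powr \<alpha>"

text \<open>
  For \<open>k = n - 1\<close> the second and the fourth term are opposite multiples of the same power and
  cancel, also when \<open>n = 2\<close> and the base \<open>n - 3\<close> is negative:
\<close>

lemma b_bound_complete:
  assumes "n \<ge> 1"
  shows "b_bound \<alpha> n (n - 1) = (real n - 1) * (real n - 2) powr \<alpha> + (2 * real n - 2) powr \<alpha>"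
proof -
  have k: "real (n - 1) = real n - 1"
    using assms by (simp add: of_nat_diff)
  have "(real n - 1 - 2 * real n)^2 + 16 * (real n - 1 - real n + 1) = (real n + 1)^2"
    by (simp add: power2_eq_square algebra_simps)
  then have r: "sqrt ((real n - 1 - 2 * real n)^2 + 16 * (real n - 1 - real n + 1)) = real n + 1"
    by (simp del: of_nat_Suc)
  have u: "real n - 2 + (real n - 1) / 2 + 1/2 * (real n + 1) = 2 * real n - 2"
    and l: "real n - 2 + (real n - 1) / 2 - 1/2 * (real n + 1) = real n - 3"
    by (simp_all add: field_simps)
  show ?thesis
    unfolding b_bound_def k r u l by (simp add: algebra_simps)
qed

end

theory Submission
  imports Defs "Jordan_Normal_Form.Spectral_Radius"
begin

text \<open>
  Adding an edge to a graph adds a positive semidefinite matrix of positive trace to its signless Laplacian, and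
  the trace of \<open>Q\<^sup>\<alpha>\<close> is strictly monotone under such additions for \<open>\<alpha> \<ge> 1\<close>
  (\<open>spectral_sum_powr_strict_mono\<close>, \<open>S_sum_strict_mono\<close>). So only the edge-maximal graphs matter.

  For \<open>k = n - 1\<close> the only edge-maximal graph is \<open>K\<^sub>n\<close>. For \<open>k \<le> n - 2\<close> the graph \<open>G\<close> has a separator of exactly \<open>k\<close> vertices
  (\<open>small_separator\<close>), and filling in all edges that do not join the two sides \<open>A\<close> and \<open>B\<close> of the rest produces
  \<open>K\<^sub>k \<or> (K\<^sub>a \<union> K\<^sub>b)\<close> with \<open>a + b = n - k\<close>. The cliques of this graph are classes of adjacent twins, which
  reduces its spectrum to that of a \<open>3 \<times> 3\<close> quotient matrix (\<open>S_sum_twin_classes\<close>, \<open>S_sum_joined_cliques\<close>):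
  \<open>n - 2\<close> with multiplicity \<open>k\<close>, \<open>k + a - 2\<close> with multiplicity \<open>a - 1\<close>, \<open>k + b - 2\<close> with multiplicity \<open>b - 1\<close>, and
  two eigenvalues with sum \<open>2n + k - 4\<close> and discriminant \<open>(k - 2n)\<^sup>2 - 16ab\<close>.

  Among all divisions \<open>a + b = n - k\<close> the power sum is largest for the most unbalanced one. The two special
  eigenvalues spread as \<open>ab\<close> decreases, which helps by convexity (\<open>quotient_eigenvalues_unbalanced\<close>); the eigenvalues
  of the two cliques contribute strictly less unless \<open>a = 1\<close> or \<open>b = 1\<close> (\<open>clique_sizes_unbalanced\<close>). For the sizes
  \<open>1\<close> and \<open>n - k - 1\<close> the value is \<open>b_bound\<close>, so equality forces \<open>G\<close> to be edge-maximal and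
  one of the two cliques to be a single vertex.
\<close>

section \<open>Convexity of powers\<close>

text \<open>
  The function \<open>x\<^sup>p\<close> lies above each of its tangents on \<open>[0, \<infinity>)\<close>. At \<open>a = 0\<close> the slope
  \<open>p * 0 powr (p - 1)\<close> is \<open>0\<close> for every \<open>p\<close>, since \<open>0 powr 0 = 0\<close>; this is still a subgradient when \<open>p = 1\<close>
  because only \<open>b \<ge> 0\<close> is considered.
\<close>
lemma powr_above_tangent:
  fixes a b p :: real
  assumes "1 \<le> p" "0 \<le> a" "0 \<le> b"
  shows "a powr p + p * a powr (p - 1) * (b - a) \<le> b powr p"
    and "1 < p \<Longrightarrow> a < b \<Longrightarrow> a powr p + p * a powr (p - 1) * (b - a) < b powr p"
proof -
  let ?f = "\<lambda>x :: real. x powr p" and ?f' = "\<lambda>x :: real. p * x powr (p - 1)"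
  have der: "DERIV ?f x :> ?f' x" if "0 < x" for x
    using that by (auto intro!: derivative_eq_intros)
  have "?f a + ?f' a * (b - a) \<le> ?f b \<and> (1 < p \<longrightarrow> a < b \<longrightarrow> ?f a + ?f' a * (b - a) < ?f b)"
  proof (cases "a = 0 \<or> b = 0")
    case True
    have "?f a + ?f' a * (0 - a) \<le> 0"
    proof -
      have "?f a = a powr (p - 1) * a"
        using \<open>0 \<le> a\<close> by (cases "a = 0") (auto simp: powr_mult_base[symmetric] mult.commute powr_diff)
      then have "?f a + ?f' a * (0 - a) = (1 - p) * ?f a" by (simp add: algebra_simps)
      also have "\<dots> \<le> 0" using \<open>1 \<le> p\<close> by (simp add: mult_nonpos_nonneg)
      finally show ?thesis .
    qed
    with True assms show ?thesis by auto
  next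
    case False
    with assms have pos: "0 < a" "0 < b" by auto
    show ?thesis
    proof (cases a b rule: linorder_cases)
      case equal
      then show ?thesis by simp
    next
      case less
      then obtain x where x: "a < x" "x < b" "?f b - ?f a = (b - a) * ?f' x"
        using MVT2[of a b ?f ?f'] der pos by (meson less_le_trans)
      have "?f' a \<le> ?f' x" using x pos assms by (intro mult_left_mono powr_mono2) auto
      then have 1: "(b - a) * ?f' a \<le> (b - a) * ?f' x" by (rule mult_left_mono) (use less in auto)
      have "?f' a < ?f' x" if "1 < p"
        using x pos that by (intro mult_strict_left_mono powr_less_mono2) auto
      then have "(b - a) * ?f' a < (b - a) * ?f' x" if "1 < p" using less that by auto
      with 1 x(3) show ?thesis by (auto simp: algebra_simps)
    next
      case greater
      then obtain x where x: "b < x" "x < a" "?f a - ?f b = (a - b) * ?f' x"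
        using MVT2[of b a ?f ?f'] der pos by (meson less_le_trans)
      have "?f' x \<le> ?f' a" using x pos assms by (intro mult_left_mono powr_mono2) auto
      then have "(a - b) * ?f' x \<le> (a - b) * ?f' a" by (rule mult_left_mono) (use greater in auto)
      with x(3) greater show ?thesis by (auto simp: algebra_simps)
    qed
  qed
  then show "?f a + ?f' a * (b - a) \<le> ?f b" "1 < p \<Longrightarrow> a < b \<Longrightarrow> ?f a + ?f' a * (b - a) < ?f b"
    by auto
qed

text \<open>
  Moving two numbers apart while keeping their sum does not decrease the value of a convex function
  summed over them: add the tangent inequalities at \<open>x\<close> and \<open>y\<close> and use that the slope at \<open>x\<close> is the larger one.
\<close>
lemma powr_sum_spread:
  fixes x y x' y' p :: real
  assumes "1 \<le> p" "0 \<le> y'" "y' \<le> y" "y \<le> x" "x + y = x' + y'"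
  shows "x powr p + y powr p \<le> x' powr p + y' powr p"
proof -
  have "x powr p + p * x powr (p - 1) * (x' - x) \<le> x' powr p"
       "y powr p + p * y powr (p - 1) * (y' - y) \<le> y' powr p"
    using assms by (auto intro!: powr_above_tangent)
  moreover have "y' - y = - (x' - x)" using assms by simp
  moreover have "p * y powr (p - 1) * (x' - x) \<le> p * x powr (p - 1) * (x' - x)"
    using assms by (intro mult_right_mono mult_left_mono powr_mono2) auto
  ultimately show ?thesis by (simp add: algebra_simps)
qed

section \<open>The spectral theorem for real symmetric matrices\<close>

text \<open>
  A complex eigenvalue exists because the characteristic polynomial splits over the complex numbers.
  It is real because the Hermitian form of the matrix at an eigenvector is its own conjugate.
\<close>
lemma real_symmetric_eigenvalue:
  fixes A :: "real mat"
  assumes A: "A \<in> carrier_mat n n" and sym: "transpose_mat A = A" and n: "n \<noteq> 0"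
  shows "\<exists>e. eigenvalue A e"
proof -
  let ?C = "map_mat complex_of_real A"
  have C: "?C \<in> carrier_mat n n" using A by auto
  have Asym: "A $$ (i, j) = A $$ (j, i)" if "i < n" "j < n" for i j
    using that A sym by (metis carrier_matD index_transpose_mat(1))
  obtain l where l: "eigenvalue ?C l"
    using spectrum_non_empty[OF C] n unfolding spectrum_def by auto
  then obtain v where v: "v \<in> carrier_vec n" "v \<noteq> 0\<^sub>v n" "?C *\<^sub>v v = l \<cdot>\<^sub>v v"
    using A unfolding eigenvalue_def eigenvector_def by auto
  have row: "(\<Sum>j<n. of_real (A $$ (i, j)) * v $ j) = l * v $ i" if "i < n" for i
  proof -
    have "(?C *\<^sub>v v) $ i = (\<Sum>j<n. of_real (A $$ (i, j)) * v $ j)"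
      using that A v(1) by (auto simp: scalar_prod_def lessThan_atLeast0 intro!: sum.cong)
    then show ?thesis using v that by simp
  qed
  \<comment> \<open>The Hermitian form evaluated in two ways.\<close>
  let ?q = "\<Sum>i<n. \<Sum>j<n. cnj (v $ i) * of_real (A $$ (i, j)) * v $ j"
  let ?N = "\<Sum>i<n. (cmod (v $ i))\<^sup>2"
  have "?q = (\<Sum>i<n. cnj (v $ i) * (l * v $ i))"
    by (intro sum.cong refl) (simp add: row[symmetric] sum_distrib_left mult.assoc)
  also have "\<dots> = l * of_real ?N"
    by (simp add: sum_distrib_left mult_ac flip: complex_norm_square)
  finally have q: "?q = l * of_real ?N" .
  have "cnj ?q = (\<Sum>i<n. \<Sum>j<n. v $ i * of_real (A $$ (i, j)) * cnj (v $ j))"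
    by (simp add: cnj_sum)
  also have "\<dots> = (\<Sum>j<n. \<Sum>i<n. v $ i * of_real (A $$ (i, j)) * cnj (v $ j))"
    by (rule sum.swap)
  also have "\<dots> = ?q"
    by (intro sum.cong refl) (simp add: Asym mult_ac)
  finally have "cnj (l * of_real ?N) = l * of_real ?N" unfolding q .
  moreover have "?N \<noteq> 0"
  proof
    assume "?N = 0"
    then have "\<forall>i<n. v $ i = 0" by (subst (asm) sum_nonneg_eq_0_iff) auto
    with v show False by (metis eq_vecI carrier_vecD index_zero_vec)
  qed
  ultimately have "cnj l = l"
    by (metis complex_cnj_mult complex_cnj_complex_of_real mult_right_cancel of_real_eq_0_iff)
  then obtain r where r: "l = of_real r" by (metis Reals_cnj_iff Reals_cases)
  have "poly (char_poly ?C) l = 0" using l eigenvalue_root_char_poly[OF C] by simp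
  then have "poly (char_poly A) r = 0"
    unfolding r of_real_hom.char_poly_hom[OF A] by simp
  then show ?thesis using eigenvalue_root_char_poly[OF A] by auto
qed

lemma index_mult_mat_sum:
  assumes "A \<in> carrier_mat n m" "B \<in> carrier_mat m k" "i < n" "j < k"
  shows "(A * B) $$ (i, j) = (\<Sum>l<m. A $$ (i, l) * B $$ (l, j))"
  using assms by (auto simp: scalar_prod_def lessThan_atLeast0 intro!: sum.cong)

text \<open>
  The reflection in the hyperplane orthogonal to \<open>w\<close>, the difference of the first unit vector and \<open>v\<close>, exchanges
  these two unit vectors.
\<close>
lemma householder_reflection:
  fixes v :: "real vec"
  assumes v: "v \<in> carrier_vec n" and unit: "v \<bullet> v = 1" and n: "0 < n"
  shows "\<exists>H \<in> carrier_mat n n. transpose_mat H = H \<and> H * H = 1\<^sub>m n \<and> col H 0 = v"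
proof -
  define w where "w i = (if i = 0 then 1 else 0) - v $ i" for i
  \<comment> \<open>When \<open>v\<close> is already the first unit vector, \<open>c = 1 / 0 = 0\<close> and the reflection degenerates to
    the identity, as it should.\<close>
  define c where "c = 1 / (1 - v $ 0)"
  define H where "H = mat n n (\<lambda>(i, j). (if i = j then 1 else 0) - c * w i * w j)"
  have H: "H \<in> carrier_mat n n" by (simp add: H_def)
  have vv: "(\<Sum>i<n. (v $ i)\<^sup>2) = 1"
    using unit v by (simp add: scalar_prod_def lessThan_atLeast0 power2_eq_square)
  have "(\<Sum>i<n. (w i)\<^sup>2) = (\<Sum>i<n. (if i = 0 then 1 else 0) - 2 * (if i = 0 then v $ 0 else 0) + (v $ i)\<^sup>2)"
    by (intro sum.cong refl) (auto simp: w_def power2_eq_square algebra_simps)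
  also have "\<dots> = 2 * (1 - v $ 0)"
    using n by (simp add: sum.distrib sum_subtractf vv flip: sum_distrib_left)
  finally have ww: "(\<Sum>i<n. (w i)\<^sup>2) = 2 * (1 - v $ 0)" .
  have cc: "c * c * (\<Sum>i<n. (w i)\<^sup>2) = 2 * c"
    unfolding ww by (cases "v $ 0 = 1") (simp_all add: c_def divide_simps)
  have "transpose_mat H = H"
    by (rule eq_matI) (auto simp: H_def)
  moreover have "H * H = 1\<^sub>m n"
  proof (rule eq_matI)
    fix i j assume "i < dim_row (1\<^sub>m n :: real mat)" "j < dim_col (1\<^sub>m n :: real mat)"
    then have ij: "i < n" "j < n" by auto
    have "(H * H) $$ (i, j) = (\<Sum>l<n. H $$ (i, l) * H $$ (l, j))"
      by (rule index_mult_mat_sum[OF H H ij])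
    also have "\<dots> = (\<Sum>l<n. (if l = i then if i = j then 1 else 0 else 0)
        - (if l = i then c * w i * w j else 0) - (if l = j then c * w i * w j else 0)
        + c * c * (w l)\<^sup>2 * (w i * w j))"
      using ij by (intro sum.cong refl) (auto simp: H_def power2_eq_square algebra_simps)
    also have "\<dots> = (if i = j then 1 else 0) - 2 * (c * w i * w j)
        + c * c * (\<Sum>l<n. (w l)\<^sup>2) * (w i * w j)"
      using ij by (simp add: sum.distrib sum_subtractf sum_distrib_left sum_distrib_right)
    also have "\<dots> = (1\<^sub>m n) $$ (i, j)"
      unfolding cc using ij by simp
    finally show "(H * H) $$ (i, j) = (1\<^sub>m n) $$ (i, j)" .
  qed (use H in auto)
  moreover have "col H 0 = v"
  proof (rule eq_vecI)
    fix i assume i: "i < dim_vec v"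
    then have i': "i < n" using v by auto
    have "H $$ (i, 0) = v $ i"
    proof (cases "v $ 0 = 1")
      case True
      have "(\<Sum>i\<in>{..<n} - {0}. (v $ i)\<^sup>2) = 0"
        using vv n True by (simp add: sum.remove[of _ 0])
      then have "v $ i = 0" if "i \<noteq> 0"
        using that i' by (subst (asm) sum_nonneg_eq_0_iff) auto
      then show ?thesis using i' n True by (auto simp: H_def c_def)
    next
      case False
      then show ?thesis using i' n by (simp add: H_def c_def w_def)
    qed
    then show "col H 0 $ i = v $ i" using H i' n by auto
  qed (use v H in auto)
  ultimately show ?thesis using H by blast
qed

text \<open>
  By induction on the size: conjugating with the Householder reflection that sends the first unit
  vector to a unit eigenvector splits off that eigenvector, and by symmetry the first row vanishes off the
  diagonal together with the first column, so that a smaller symmetric matrix remains.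
\<close>
lemma real_spectral_theorem:
  fixes A :: "real mat"
  assumes "A \<in> carrier_mat n n" "transpose_mat A = A"
  shows "\<exists>U D. U \<in> carrier_mat n n \<and> D \<in> carrier_mat n n \<and> diagonal_mat D \<and>
    transpose_mat U * U = 1\<^sub>m n \<and> U * transpose_mat U = 1\<^sub>m n \<and> A = U * D * transpose_mat U"
  using assms
proof (induction n arbitrary: A)
  case 0
  then show ?case
    by (intro exI[of _ "1\<^sub>m 0"] exI[of _ A]) (auto simp: diagonal_mat_def)
next
  case (Suc n)
  note A = Suc.prems(1) and symA = Suc.prems(2)
  obtain e where "eigenvalue A e" using real_symmetric_eigenvalue[OF A symA] by auto
  then obtain u where u: "u \<in> carrier_vec (Suc n)" "u \<noteq> 0\<^sub>v (Suc n)" "A *\<^sub>v u = e \<cdot>\<^sub>v u"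
    using A unfolding eigenvalue_def eigenvector_def by auto
  have uu: "0 < u \<bullet> u"
    using conjugate_square_greater_0_vec[OF u(1)] u(2) by simp
  define v where "v = (1 / sqrt (u \<bullet> u)) \<cdot>\<^sub>v u"
  have v: "v \<in> carrier_vec (Suc n)" "v \<bullet> v = 1" "A *\<^sub>v v = e \<cdot>\<^sub>v v"
    using u A uu by (auto simp: v_def mult_mat_vec[of A _ "Suc n"] smult_smult_assoc mult.commute)
  obtain H where H: "H \<in> carrier_mat (Suc n) (Suc n)" "transpose_mat H = H"
      "H * H = 1\<^sub>m (Suc n)" "col H 0 = v"
    using householder_reflection[OF v(1,2)] by auto
  define B where "B = H * A * H"
  have B: "B \<in> carrier_mat (Suc n) (Suc n)" using H A by (simp add: B_def)
  have symB: "transpose_mat B = B"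
  proof -
    have "transpose_mat B = H * (A * H)"
      using H(1,2) A symA unfolding B_def
      by (simp add: transpose_mult[of _ "Suc n" "Suc n" _ "Suc n"])
    then show ?thesis
      using H(1) A by (simp add: B_def assoc_mult_mat[of _ "Suc n" "Suc n" _ "Suc n" _ "Suc n"])
  qed
  have ABH: "A = H * B * H"
  proof -
    have "H * B * H = (H * H) * A * (H * H)"
      unfolding B_def using H(1) A
      by (simp add: assoc_mult_mat[of _ "Suc n" "Suc n" _ "Suc n" _ "Suc n"] del: H)
    then show ?thesis using H A by simp
  qed
  have "col B 0 = H *\<^sub>v (A *\<^sub>v v)"
  proof -
    have "B = H * (A * H)"
      using H(1) A by (simp add: B_def assoc_mult_mat[of _ "Suc n" "Suc n" _ "Suc n" _ "Suc n"])
    then show ?thesis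
      using H A by (simp add: col_mult2[of _ "Suc n" "Suc n" _ "Suc n"]) (simp add: mult_mat_vec_def)
  qed
  also have "\<dots> = e \<cdot>\<^sub>v (H *\<^sub>v v)"
    using H v by (simp add: mult_mat_vec[of _ "Suc n" "Suc n"])
  also have "H *\<^sub>v v = col (H * H) 0"
    using H(1,4) by (simp add: col_mult2[of _ "Suc n" "Suc n"]) (simp add: mult_mat_vec_def)
  finally have col0: "col B 0 = e \<cdot>\<^sub>v unit_vec (Suc n) 0"
    using H by simp
  have B0: "B $$ (i, 0) = (if i = 0 then e else 0)" if "i < Suc n" for i
    using arg_cong[OF col0, of "\<lambda>w. w $ i"] that B by (auto simp: unit_vec_def)
  have Bsym: "B $$ (i, j) = B $$ (j, i)" if "i < Suc n" "j < Suc n" for i j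
    using that B symB by (metis carrier_matD index_transpose_mat(1))
  define B' where "B' = mat n n (\<lambda>(i, j). B $$ (Suc i, Suc j))"
  have B': "B' \<in> carrier_mat n n" by (simp add: B'_def)
  have Bblock: "B = four_block_mat (e \<cdot>\<^sub>m 1\<^sub>m 1) (0\<^sub>m 1 n) (0\<^sub>m n 1) B'"
  proof (rule eq_matI)
    fix i j assume "i < dim_row (four_block_mat (e \<cdot>\<^sub>m 1\<^sub>m 1) (0\<^sub>m 1 n) (0\<^sub>m n 1) B')"
      "j < dim_col (four_block_mat (e \<cdot>\<^sub>m 1\<^sub>m 1) (0\<^sub>m 1 n) (0\<^sub>m n 1) B')"
    then have ij: "i < Suc n" "j < Suc n" using B' by auto
    then show "B $$ (i, j) = four_block_mat (e \<cdot>\<^sub>m 1\<^sub>m 1) (0\<^sub>m 1 n) (0\<^sub>m n 1) B' $$ (i, j)"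
      using B' B0[of i] B0[of j] Bsym[of i j] by (cases i; cases j) (auto simp: B'_def)
  qed (use B B' in auto)
  have "transpose_mat B' = B'"
    by (rule eq_matI) (auto simp: B'_def Bsym)
  from Suc.IH[OF B' this] obtain U' D' where
    U': "U' \<in> carrier_mat n n" "D' \<in> carrier_mat n n" "diagonal_mat D'"
      "transpose_mat U' * U' = 1\<^sub>m n" "U' * transpose_mat U' = 1\<^sub>m n" "B' = U' * D' * transpose_mat U'"
    by blast
  define V where "V = four_block_mat (1\<^sub>m 1) (0\<^sub>m 1 n) (0\<^sub>m n 1) U'"
  define D where "D = four_block_mat (e \<cdot>\<^sub>m 1\<^sub>m 1) (0\<^sub>m 1 n) (0\<^sub>m n 1) D'"
  have V: "V \<in> carrier_mat (Suc n) (Suc n)" and D: "D \<in> carrier_mat (Suc n) (Suc n)"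
    using U' by (auto simp: V_def D_def)
  have tV: "transpose_mat V = four_block_mat (1\<^sub>m 1) (0\<^sub>m 1 n) (0\<^sub>m n 1) (transpose_mat U')"
    unfolding V_def using U' by (subst transpose_four_block_mat) (auto intro: one_carrier_mat)
  have tVV: "transpose_mat V * V = 1\<^sub>m (Suc n)" and VtV: "V * transpose_mat V = 1\<^sub>m (Suc n)"
    unfolding tV unfolding V_def using U'
    by (simp_all add: mult_four_block_mat[of _ 1 1 _ n _ n _ _ 1 _ n] del: One_nat_def, simp_all)
  have BV: "B = V * D * transpose_mat V"
    unfolding tV unfolding V_def D_def Bblock using U'
    by (simp add: mult_four_block_mat[of _ 1 1 _ n _ n _ _ 1 _ n] del: One_nat_def)
  have tHV: "transpose_mat (H * V) = transpose_mat V * H"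
    using H V by (simp add: transpose_mult[of _ "Suc n" "Suc n"])
  note assoc = assoc_mult_mat[of _ "Suc n" "Suc n" _ "Suc n" _ "Suc n"]
  have "transpose_mat (H * V) * (H * V) = transpose_mat V * (H * H) * V"
    unfolding tHV using H(1) V by (simp add: assoc del: H)
  then have 1: "transpose_mat (H * V) * (H * V) = 1\<^sub>m (Suc n)"
    using H V tVV by simp
  have "(H * V) * transpose_mat (H * V) = H * (V * transpose_mat V) * H"
    unfolding tHV using H(1) V by (simp add: assoc del: H)
  then have 2: "(H * V) * transpose_mat (H * V) = 1\<^sub>m (Suc n)"
    using H V VtV by simp
  have 3: "A = (H * V) * D * transpose_mat (H * V)"
    unfolding tHV unfolding ABH BV using H(1) V D by (simp add: assoc del: H)
  have "diagonal_mat D"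
    unfolding diagonal_mat_def
  proof (intro allI impI)
    fix i j assume "i < dim_row D" "j < dim_col D" "i \<noteq> j"
    then show "D $$ (i, j) = 0"
      using U'(2,3) by (cases i; cases j) (auto simp: D_def diagonal_mat_def)
  qed
  with 1 2 3 H V D show ?case by (metis mult_carrier_mat)
qed

section \<open>Strict monotonicity of spectral power sums\<close>

text \<open>
  For a symmetric matrix this is the trace of \<open>f(A)\<close>.
\<close>
definition spectral_sum :: "(real \<Rightarrow> real) \<Rightarrow> real mat \<Rightarrow> real" where
  "spectral_sum f A = (\<Sum>q \<in># proots (char_poly A). f q)"

definition quad_form :: "real mat \<Rightarrow> (nat \<Rightarrow> real) \<Rightarrow> real" where
  "quad_form A x = (\<Sum>i<dim_row A. \<Sum>j<dim_row A. x i * A $$ (i, j) * x j)"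

lemma spectral_sum_linear_factors:
  assumes "char_poly A = (\<Prod>k\<in>K. [:- d k, 1:])"
  shows "spectral_sum f A = (\<Sum>k\<in>K. f (d k))"
proof -
  have "(\<Sum>q \<in># (\<Sum>k\<in>K. {#d k#}). f q) = (\<Sum>k\<in>K. f (d k))"
    by (induction K rule: infinite_finite_induct) auto
  then show ?thesis
    unfolding spectral_sum_def assms by (subst proots_prod) auto
qed

text \<open>
  The spectral theorem in coordinates: the columns of \<open>u\<close> are an orthonormal eigenbasis with eigenvalues
  \<open>d\<close>. Both orthogonality relations are listed because the double sums below use rows and columns.
\<close>
lemma real_spectral_decomposition:
  fixes A :: "real mat"
  assumes A: "A \<in> carrier_mat n n" and sym: "transpose_mat A = A"
  obtains u d where
    "\<And>i j. i < n \<Longrightarrow> j < n \<Longrightarrow> (\<Sum>l<n. u l i * u l j) = (if i = j then 1 else 0)"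
    "\<And>i j. i < n \<Longrightarrow> j < n \<Longrightarrow> (\<Sum>l<n. u i l * u j l) = (if i = j then 1 else 0)"
    "\<And>i j. i < n \<Longrightarrow> j < n \<Longrightarrow> A $$ (i, j) = (\<Sum>l<n. d l * u i l * u j l)"
    "char_poly A = (\<Prod>l<n. [:- d l, 1:])"
proof -
  obtain U D where U: "U \<in> carrier_mat n n" and D: "D \<in> carrier_mat n n" and diag: "diagonal_mat D"
    and tUU: "transpose_mat U * U = 1\<^sub>m n" and UtU: "U * transpose_mat U = 1\<^sub>m n"
    and eq: "A = U * D * transpose_mat U"
    using real_spectral_theorem[OF A sym] by blast
  have tU: "transpose_mat U \<in> carrier_mat n n" and UD: "U * D \<in> carrier_mat n n" using U D by auto
  have UDe: "(U * D) $$ (i, l) = U $$ (i, l) * D $$ (l, l)" if "i < n" "l < n" for i l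
  proof -
    have "(U * D) $$ (i, l) = (\<Sum>m<n. U $$ (i, m) * D $$ (m, l))"
      by (rule index_mult_mat_sum[OF U D that])
    also have "\<dots> = (\<Sum>m<n. if m = l then U $$ (i, l) * D $$ (l, l) else 0)"
      using diag D that by (intro sum.cong refl) (auto simp: diagonal_mat_def)
    finally show ?thesis using that by simp
  qed
  show thesis
  proof (rule that[of "\<lambda>i j. U $$ (i, j)" "\<lambda>l. D $$ (l, l)"])
    fix i j assume ij: "i < n" "j < n"
    show "(\<Sum>l<n. U $$ (l, i) * U $$ (l, j)) = (if i = j then 1 else 0)"
      using index_mult_mat_sum[OF tU U ij] ij U by (simp add: tUU)
    show "(\<Sum>l<n. U $$ (i, l) * U $$ (j, l)) = (if i = j then 1 else 0)"
      using index_mult_mat_sum[OF U tU ij] ij U by (simp add: UtU)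
    have "A $$ (i, j) = (\<Sum>l<n. (U * D) $$ (i, l) * transpose_mat U $$ (l, j))"
      unfolding eq by (rule index_mult_mat_sum[OF UD tU ij])
    then show "A $$ (i, j) = (\<Sum>l<n. D $$ (l, l) * U $$ (i, l) * U $$ (j, l))"
      using ij U by (simp add: UDe mult_ac)
  next
    have "similar_mat A D"
      by (rule similar_matI[of _ _ U "transpose_mat U" n]) (use U D A tUU UtU eq in auto)
    then have "char_poly A = char_poly D" by (rule char_poly_similar)
    also have "\<dots> = (\<Prod>a\<leftarrow>diag_mat D. [:- a, 1:])"
      using diag D by (intro char_poly_upper_triangular[OF D]) (auto simp: diagonal_mat_def)
    also have "\<dots> = (\<Prod>l<n. [:- D $$ (l, l), 1:])"
      using D by (simp add: diag_mat_def o_def lessThan_atLeast0 flip: prod.list_conv_set_nth)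
        (subst prod.distinct_set_conv_list[symmetric], auto)
    finally show "char_poly A = (\<Prod>l<n. [:- D $$ (l, l), 1:])" .
  qed
qed

lemma quad_form_decomposition:
  assumes A: "A \<in> carrier_mat n n"
    and dec: "\<And>i j. i < n \<Longrightarrow> j < n \<Longrightarrow> A $$ (i, j) = (\<Sum>l<n. d l * u i l * u j l)"
  shows "quad_form A x = (\<Sum>l<n. d l * (\<Sum>i<n. x i * u i l)\<^sup>2)"
proof -
  have "quad_form A x = (\<Sum>i<n. \<Sum>j<n. \<Sum>l<n. d l * (x i * u i l) * (x j * u j l))"
    using A unfolding quad_form_def
    by (auto simp: dec sum_distrib_left sum_distrib_right mult_ac intro!: sum.cong)
  also have "\<dots> = (\<Sum>i<n. \<Sum>l<n. \<Sum>j<n. d l * (x i * u i l) * (x j * u j l))"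
    by (intro sum.cong refl sum.swap)
  also have "\<dots> = (\<Sum>l<n. \<Sum>i<n. \<Sum>j<n. d l * (x i * u i l) * (x j * u j l))"
    by (rule sum.swap)
  also have "\<dots> = (\<Sum>l<n. d l * (\<Sum>i<n. x i * u i l)\<^sup>2)"
    by (simp add: power2_eq_square sum_distrib_left sum_distrib_right mult_ac)
  finally show ?thesis .
qed

text \<open>
  Monotonicity of the trace of \<open>A\<^sup>p\<close>, by the argument behind Klein's inequality. Let \<open>u\<^sub>i, a\<^sub>i\<close> and \<open>v\<^sub>j, b\<^sub>j\<close> be
  orthonormal eigenbases and eigenvalues of \<open>A\<close> and \<open>B\<close>. The squared inner products \<open>w\<^sub>i\<^sub>j\<close> of \<open>u\<^sub>i\<close> and \<open>v\<^sub>j\<close>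
  form a doubly stochastic matrix, and \<open>\<Sum>\<^sub>j w\<^sub>i\<^sub>j b\<^sub>j\<close> is the form of \<open>B\<close> at \<open>u\<^sub>i\<close>, hence at least \<open>a\<^sub>i\<close>. Averaging the
  tangent inequality for \<open>b\<^sub>j\<close> at \<open>a\<^sub>i\<close> with the weights \<open>w\<^sub>i\<^sub>j\<close> gives the weak inequality. As the trace of \<open>B\<close> is
  strictly larger, some pair with \<open>w\<^sub>i\<^sub>j > 0\<close> has \<open>b\<^sub>j > a\<^sub>i\<close>, and there the tangent inequality is strict if
  \<open>p > 1\<close>; for \<open>p = 1\<close> both sides are traces.
\<close>
lemma spectral_sum_powr_strict_mono:
  fixes A B :: "real mat" and p :: real
  assumes A: "A \<in> carrier_mat n n" "transpose_mat A = A"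
    and B: "B \<in> carrier_mat n n" "transpose_mat B = B"
    and psd: "\<And>x. 0 \<le> quad_form A x" and le: "\<And>x. quad_form A x \<le> quad_form B x"
    and tr: "(\<Sum>i<n. A $$ (i, i)) < (\<Sum>i<n. B $$ (i, i))"
    and p: "1 \<le> p"
  shows "spectral_sum (\<lambda>q. q powr p) A < spectral_sum (\<lambda>q. q powr p) B"
proof -
  obtain u a where
    u1: "\<And>i j. i < n \<Longrightarrow> j < n \<Longrightarrow> (\<Sum>l<n. u l i * u l j) = (if i = j then 1 else 0)" and
    u2: "\<And>i j. i < n \<Longrightarrow> j < n \<Longrightarrow> (\<Sum>l<n. u i l * u j l) = (if i = j then 1 else 0)" and
    ua: "\<And>i j. i < n \<Longrightarrow> j < n \<Longrightarrow> A $$ (i, j) = (\<Sum>l<n. a l * u i l * u j l)" and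
    cA: "char_poly A = (\<Prod>l<n. [:- a l, 1:])"
    using real_spectral_decomposition[OF A] by blast
  obtain v b where
    v1: "\<And>i j. i < n \<Longrightarrow> j < n \<Longrightarrow> (\<Sum>l<n. v l i * v l j) = (if i = j then 1 else 0)" and
    v2: "\<And>i j. i < n \<Longrightarrow> j < n \<Longrightarrow> (\<Sum>l<n. v i l * v j l) = (if i = j then 1 else 0)" and
    vb: "\<And>i j. i < n \<Longrightarrow> j < n \<Longrightarrow> B $$ (i, j) = (\<Sum>l<n. b l * v i l * v j l)" and
    cB: "char_poly B = (\<Prod>l<n. [:- b l, 1:])"
    using real_spectral_decomposition[OF B] by blast
  let ?f = "\<lambda>q :: real. q powr p" and ?f' = "\<lambda>q :: real. p * q powr (p - 1)"
  define w where "w i j = (\<Sum>l<n. u l i * v l j)\<^sup>2" for i j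
  have w0: "0 \<le> w i j" for i j by (simp add: w_def)
  have quad_one: "quad_form (1\<^sub>m n) x = (\<Sum>i<n. (x i)\<^sup>2)" for x
    by (simp add: quad_form_def power2_eq_square if_distrib if_distribR cong: if_cong)
  have parseval: "(\<Sum>l<n. (\<Sum>i<n. x i * t i l)\<^sup>2) = (\<Sum>i<n. (x i)\<^sup>2)"
    if "\<And>i j. i < n \<Longrightarrow> j < n \<Longrightarrow> (\<Sum>l<n. t i l * t j l) = (if i = j then 1 else 0)"
    for t :: "nat \<Rightarrow> nat \<Rightarrow> real" and x
    using quad_form_decomposition[of "1\<^sub>m n" n "\<lambda>_. 1" t x] that by (simp add: quad_one)
  have row: "(\<Sum>j<n. w i j) = 1" if "i < n" for i
    using parseval[OF v2, of "\<lambda>l. u l i"] u1[OF that that] by (simp add: w_def power2_eq_square)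
  have col: "(\<Sum>i<n. w i j) = 1" if "j < n" for j
    using parseval[OF u2, of "\<lambda>l. v l j"] v1[OF that that]
    by (simp add: w_def power2_eq_square mult.commute)
  have qB: "quad_form B (\<lambda>l. u l i) = (\<Sum>j<n. w i j * b j)" for i
    using quad_form_decomposition[OF B(1) vb, of "\<lambda>l. u l i"] by (simp add: w_def mult.commute)
  have qA: "quad_form A (\<lambda>l. u l i) = a i" if "i < n" for i
  proof -
    have "quad_form A (\<lambda>l. u l i) = (\<Sum>l<n. a l * (\<Sum>k<n. u k i * u k l)\<^sup>2)"
      by (rule quad_form_decomposition[OF A(1) ua])
    also have "\<dots> = (\<Sum>l<n. if l = i then a i else 0)"
      using that by (intro sum.cong refl) (auto simp: u1)
    finally show ?thesis using that by simp
  qed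
  have qB': "quad_form B (\<lambda>l. v l j) = b j" if "j < n" for j
  proof -
    have "quad_form B (\<lambda>l. v l j) = (\<Sum>l<n. b l * (\<Sum>k<n. v k j * v k l)\<^sup>2)"
      by (rule quad_form_decomposition[OF B(1) vb])
    also have "\<dots> = (\<Sum>l<n. if l = j then b j else 0)"
      using that by (intro sum.cong refl) (auto simp: v1)
    finally show ?thesis using that by simp
  qed
  have a0: "0 \<le> a i" if "i < n" for i using psd[of "\<lambda>l. u l i"] qA[OF that] by simp
  have b0: "0 \<le> b j" if "j < n" for j
    using psd[of "\<lambda>l. v l j"] le[of "\<lambda>l. v l j"] qB'[OF that] by simp
  have ab: "a i \<le> (\<Sum>j<n. w i j * b j)" if "i < n" for i
    using le[of "\<lambda>l. u l i"] qA[OF that] by (simp add: qB)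
  have trace: "(\<Sum>i<n. M $$ (i, i)) = (\<Sum>l<n. d l)"
    if "\<And>i j. i < n \<Longrightarrow> j < n \<Longrightarrow> M $$ (i, j) = (\<Sum>l<n. d l * t i l * t j l)"
      "\<And>i j. i < n \<Longrightarrow> j < n \<Longrightarrow> (\<Sum>l<n. t l i * t l j) = (if i = j then 1 else 0)"
    for M :: "real mat" and d and t :: "nat \<Rightarrow> nat \<Rightarrow> real"
  proof -
    have "(\<Sum>i<n. M $$ (i, i)) = (\<Sum>i<n. \<Sum>l<n. d l * (t i l * t i l))"
      using that(1) by (auto simp: mult_ac intro!: sum.cong)
    also have "\<dots> = (\<Sum>l<n. \<Sum>i<n. d l * (t i l * t i l))" by (rule sum.swap)
    also have "\<dots> = (\<Sum>l<n. d l)"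
      using that(2) by (simp flip: sum_distrib_left)
    finally show ?thesis .
  qed
  have tr': "(\<Sum>l<n. a l) < (\<Sum>l<n. b l)"
    using tr trace[OF ua u1] trace[OF vb v1] by simp
  have SA: "spectral_sum ?f A = (\<Sum>i<n. ?f (a i))" and SB: "spectral_sum ?f B = (\<Sum>i<n. ?f (b i))"
    using spectral_sum_linear_factors[OF cA] spectral_sum_linear_factors[OF cB] by auto
  show ?thesis
  proof (cases "p = 1")
    case True
    have "(\<Sum>i<n. ?f (a i)) = (\<Sum>i<n. a i)" "(\<Sum>i<n. ?f (b i)) = (\<Sum>i<n. b i)"
      using True a0 b0 by (auto intro!: sum.cong)
    then show ?thesis using tr' by (simp add: SA SB)
  next
    case False
    with p have p1: "1 < p" by simp
    let ?T = "\<lambda>i j. ?f (a i) + ?f' (a i) * (b j - a i)"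
    have double: "(\<Sum>i<n. \<Sum>j<n. w i j * g j) = (\<Sum>j<n. g j)" for g
    proof -
      have "(\<Sum>i<n. \<Sum>j<n. w i j * g j) = (\<Sum>j<n. \<Sum>i<n. w i j * g j)" by (rule sum.swap)
      then show ?thesis by (simp add: col flip: sum_distrib_right)
    qed
    have "\<exists>i<n. \<exists>j<n. 0 < w i j * (b j - a i)"
    proof (rule ccontr)
      assume "\<not> ?thesis"
      then have "(\<Sum>i<n. \<Sum>j<n. w i j * (b j - a i)) \<le> 0"
        by (intro sum_nonpos) (meson lessThan_iff not_less)
      moreover have "(\<Sum>i<n. \<Sum>j<n. w i j * (b j - a i)) = (\<Sum>j<n. b j) - (\<Sum>i<n. a i)"
        by (simp add: right_diff_distrib sum_subtractf double row flip: sum_distrib_right)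
      ultimately show False using tr' by simp
    qed
    then obtain i0 j0 where ij0: "i0 < n" "j0 < n" "0 < w i0 j0 * (b j0 - a i0)" by auto
    then have pos: "0 < w i0 j0" "a i0 < b j0"
      using w0[of i0 j0] by (auto simp: zero_less_mult_iff)
    have term_le: "w i j * ?T i j \<le> w i j * ?f (b j)" if "i < n" "j < n" for i j
      using powr_above_tangent(1)[OF p a0[OF that(1)] b0[OF that(2)]] w0
      by (rule mult_left_mono)
    have term_less: "w i0 j0 * ?T i0 j0 < w i0 j0 * ?f (b j0)"
      using powr_above_tangent(2)[OF p a0[OF ij0(1)] b0[OF ij0(2)] p1 pos(2)] pos(1) by simp
    have "(\<Sum>i<n. ?f (a i)) \<le> (\<Sum>i<n. ?f (a i) + ?f' (a i) * ((\<Sum>j<n. w i j * b j) - a i))"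
      using ab p by (intro sum_mono) auto
    also have "\<dots> = (\<Sum>i<n. \<Sum>j<n. w i j * ?T i j)"
    proof (intro sum.cong refl)
      fix i assume "i \<in> {..<n}"
      then have r: "(\<Sum>j<n. w i j) = 1" by (simp add: row)
      have "(\<Sum>j<n. w i j * ?T i j) = (\<Sum>j<n. w i j * (?f (a i) - ?f' (a i) * a i) + ?f' (a i) * (w i j * b j))"
        by (intro sum.cong refl) (simp add: algebra_simps)
      also have "\<dots> = (\<Sum>j<n. w i j) * (?f (a i) - ?f' (a i) * a i) + ?f' (a i) * (\<Sum>j<n. w i j * b j)"
        by (simp only: sum.distrib sum_distrib_left sum_distrib_right)
      finally show "?f (a i) + ?f' (a i) * ((\<Sum>j<n. w i j * b j) - a i) = (\<Sum>j<n. w i j * ?T i j)"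
        unfolding r by (simp add: algebra_simps)
    qed
    also have "\<dots> < (\<Sum>i<n. \<Sum>j<n. w i j * ?f (b j))"
    proof (rule sum_strict_mono_ex1)
      show "\<forall>i\<in>{..<n}. (\<Sum>j<n. w i j * ?T i j) \<le> (\<Sum>j<n. w i j * ?f (b j))"
        using term_le by (auto intro!: sum_mono)
      have "(\<Sum>j<n. w i0 j * ?T i0 j) < (\<Sum>j<n. w i0 j * ?f (b j))"
        using term_le[OF ij0(1)] term_less ij0(2) by (intro sum_strict_mono_ex1) auto
      then show "\<exists>i\<in>{..<n}. (\<Sum>j<n. w i j * ?T i j) < (\<Sum>j<n. w i j * ?f (b j))"
        using ij0(1) by auto
    qed simp
    also have "\<dots> = (\<Sum>j<n. ?f (b j))" by (rule double)
    finally show ?thesis by (simp only: SA SB)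
  qed
qed

section \<open>Matrices with classes of twin indices\<close>

lemma det_3:
  fixes A :: "'a :: comm_ring_1 mat"
  assumes A: "A \<in> carrier_mat 3 3"
  shows "det A = A $$ (0,0) * (A $$ (1,1) * A $$ (2,2) - A $$ (1,2) * A $$ (2,1))
    - A $$ (0,1) * (A $$ (1,0) * A $$ (2,2) - A $$ (1,2) * A $$ (2,0))
    + A $$ (0,2) * (A $$ (1,0) * A $$ (2,1) - A $$ (1,1) * A $$ (2,0))"
proof -
  have det_2: "det B = B $$ (0,0) * B $$ (1,1) - B $$ (0,1) * B $$ (1,0)"
    if B: "B \<in> carrier_mat 2 2" for B :: "'a mat"
  proof -
    have "det B = (\<Sum>j<2. B $$ (0,j) * cofactor B 0 j)"
      by (rule laplace_expansion_row[OF B]) simp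
    moreover have "det (mat_delete B 0 j) = B $$ (1, 1 - j)" if "j < 2" for j
      using that B by (subst det_single) (auto simp: mat_delete_def mat_delete_carrier less_2_cases_iff)
    ultimately show ?thesis
      by (simp add: cofactor_def numeral_2_eq_2)
  qed
  have "det A = (\<Sum>j<3. A $$ (0,j) * cofactor A 0 j)"
    by (rule laplace_expansion_row[OF A]) simp
  moreover have "det (mat_delete A 0 j) =
      A $$ (1, if j = 0 then 1 else 0) * A $$ (2, if j < 2 then 2 else 1)
      - A $$ (1, if j < 2 then 2 else 1) * A $$ (2, if j = 0 then 1 else 0)" for j
    using A by (subst det_2) (auto simp: mat_delete_def numeral_2_eq_2)
  moreover have "{..<3} = {0, 1, 2 :: nat}" by auto
  ultimately show ?thesis
    by (simp add: cofactor_def algebra_simps)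
qed

text \<open>
  The index set is partitioned into classes, \<open>c i\<close> being the class of \<open>i\<close>, and the indices below \<open>t\<close>
  represent the classes. The entries depend on the classes only, apart from a diagonal that is constant on
  each class. For an index \<open>j\<close> that is not a representative, the difference of the unit vectors at \<open>j\<close> and
  at \<open>c j\<close> is an eigenvector for \<open>d (c j)\<close>. The matrix \<open>P\<close> changes to the basis that consists of these
  differences and of the unit vectors at the representatives; it is unitriangular, with inverse \<open>Q\<close>, and
  makes the matrix block triangular with the \<open>t \<times> t\<close> quotient matrix as one diagonal block.
\<close>
lemma char_poly_twin_classes:
  fixes d :: "nat \<Rightarrow> real" and r :: "nat \<Rightarrow> nat \<Rightarrow> real" and c :: "nat \<Rightarrow> nat"
  assumes tn: "t \<le> n" and ct: "\<And>i. i < n \<Longrightarrow> c i < t" and rep: "\<And>s. s < t \<Longrightarrow> c s = s"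
  shows "char_poly (mat n n (\<lambda>(i, j). (if i = j then d (c i) else 0) + r (c i) (c j))) =
    char_poly (mat t t (\<lambda>(s, s'). (if s = s' then d s else 0) + real (card {i. i < n \<and> c i = s}) * r s s'))
    * (\<Prod>j\<in>{t..<n}. [:- d (c j), 1:])"
    (is "char_poly ?M = char_poly ?R * _")
proof -
  let ?m = "\<lambda>s. real (card {i. i < n \<and> c i = s})"
  define Q :: "real mat" where
    "Q = mat n n (\<lambda>(i, k). if i < t then (if c k = i then 1 else 0) else if i = k then 1 else 0)"
  define P :: "real mat" where
    "P = mat n n (\<lambda>(k, j). (if k = j then 1 else 0) - (if t \<le> j \<and> k = c j then 1 else 0))"
  define N where "N = mat n n (\<lambda>(i, j).
    if j < t then (if i < t then (if i = j then d i else 0) + ?m i * r i j else r (c i) j)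
    else if i = j then d (c i) else 0)"
  have M: "?M \<in> carrier_mat n n" and Q: "Q \<in> carrier_mat n n" and P: "P \<in> carrier_mat n n"
    and N: "N \<in> carrier_mat n n"
    by (auto simp: Q_def P_def N_def)
  have MP: "?M * P \<in> carrier_mat n n" using M P by auto
  have cc: "c (c j) = c j" "c j < n" if "j < n" for j
    using ct[OF that] rep tn by auto
  have Qmul: "(Q * X) $$ (i, j) = (if i < t then \<Sum>k | k < n \<and> c k = i. X $$ (k, j) else X $$ (i, j))"
    if X: "X \<in> carrier_mat n n" and ij: "i < n" "j < n" for X i j
  proof -
    have "(Q * X) $$ (i, j) = (\<Sum>k<n. Q $$ (i, k) * X $$ (k, j))"
      by (rule index_mult_mat_sum[OF Q X ij])
    also have "\<dots> = (\<Sum>k<n. if (if i < t then c k = i else i = k) then X $$ (k, j) else 0)"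
      using ij by (intro sum.cong refl) (auto simp: Q_def)
    also have "\<dots> = (\<Sum>k | k < n \<and> (if i < t then c k = i else i = k). X $$ (k, j))"
      by (subst sum.inter_filter[symmetric]) (auto simp: lessThan_def intro!: sum.cong)
    also have "\<dots> = (if i < t then \<Sum>k | k < n \<and> c k = i. X $$ (k, j) else X $$ (i, j))"
      using ij by (auto simp: conj_commute cong: conj_cong)
    finally show ?thesis .
  qed
  have Pmul: "(X * P) $$ (i, j) = X $$ (i, j) - (if t \<le> j then X $$ (i, c j) else 0)"
    if X: "X \<in> carrier_mat n n" and ij: "i < n" "j < n" for X i j
  proof -
    have "(X * P) $$ (i, j) = (\<Sum>k<n. X $$ (i, k) * P $$ (k, j))"
      by (rule index_mult_mat_sum[OF X P ij])
    also have "\<dots> = (\<Sum>k<n. (if k = j then X $$ (i, j) else 0)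
        - (if k = c j then (if t \<le> j then X $$ (i, c j) else 0) else 0))"
      using ij by (intro sum.cong refl) (auto simp: P_def)
    finally show ?thesis using ij cc by (simp add: sum_subtractf)
  qed
  have QP: "Q * P = 1\<^sub>m n"
  proof (rule eq_matI)
    fix i j assume "i < dim_row (1\<^sub>m n :: real mat)" "j < dim_col (1\<^sub>m n :: real mat)"
    then have ij: "i < n" "j < n" by auto
    show "(Q * P) $$ (i, j) = 1\<^sub>m n $$ (i, j)"
      using ij Pmul[OF Q ij] cc[of j] ct[of j] rep tn
      by (auto simp: Q_def)
  qed (use Q P in auto)
  then have PQ: "P * Q = 1\<^sub>m n"
    by (rule mat_mult_left_right_inverse[OF Q P])
  have NQMP: "N = Q * ?M * P"
  proof -
    have "N = Q * (?M * P)"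
    proof (rule eq_matI)
      fix i j assume "i < dim_row (Q * (?M * P))" "j < dim_col (Q * (?M * P))"
      then have ij: "i < n" "j < n" using Q P by auto
      have MPe: "(?M * P) $$ (k, j) = (if j < t then (if k = j then d j else 0) + r (c k) j
          else (if k = j then d (c j) else 0) - (if k = c j then d (c j) else 0))" if "k < n" for k
        using Pmul[OF M that ij(2)] that ij cc[of j] rep[of j] by auto
      show "N $$ (i, j) = (Q * (?M * P)) $$ (i, j)"
      proof (cases "i < t")
        case False
        then show ?thesis
          using ij Qmul[OF MP ij] MPe[of i] ct[of j] by (auto simp: N_def)
      next
        case True
        have "(Q * (?M * P)) $$ (i, j) = (\<Sum>k | k < n \<and> c k = i. (?M * P) $$ (k, j))"
          using Qmul[OF MP ij] True by simp
        also have "\<dots> = (\<Sum>k | k < n \<and> c k = i. if j < t then (if k = j then d j else 0) + r i j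
          else (if k = j then d (c j) else 0) - (if k = c j then d (c j) else 0))"
          by (intro sum.cong refl) (auto simp: MPe)
        also have "\<dots> = (if j < t then (if i = j then d i else 0) + ?m i * r i j else 0)"
          using ij rep[of j] cc[of j] by (auto simp: sum.distrib sum_subtractf)
        also have "\<dots> = N $$ (i, j)" using True ij by (auto simp: N_def)
        finally show ?thesis by simp
      qed
    qed (use N Q P in auto)
    then show ?thesis by (rule trans[OF _ assoc_mult_mat[OF Q M P, symmetric]])
  qed
  have "similar_mat N ?M"
    by (rule similar_matI[OF _ QP PQ NQMP]) (use M N P Q in simp)
  then have "char_poly ?M = char_poly N" by (rule char_poly_similar[symmetric])
  also have "\<dots> = char_poly ?R * char_poly (mat (n - t) (n - t) (\<lambda>(i, j). if i = j then d (c (t + i)) else 0))"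
    (is "_ = _ * char_poly ?D")
  proof -
    let ?X = "mat (n - t) t (\<lambda>(i, j). [:- r (c (t + i)) j:])"
    have "char_poly_matrix N =
      four_block_mat (char_poly_matrix ?R) (0\<^sub>m t (n - t)) ?X (char_poly_matrix ?D)"
      by (rule eq_matI) (use tn in \<open>auto simp: N_def char_poly_matrix_def\<close>)
    then show ?thesis
      unfolding char_poly_def
      by (simp add: det_four_block_mat_upper_right_zero[of _ t _ "n - t"])
  qed
  also have "char_poly ?D = (\<Prod>a\<leftarrow>diag_mat ?D. [:- a, 1:])"
    by (rule char_poly_upper_triangular) auto
  also have "\<dots> = (\<Prod>j<n - t. [:- d (c (t + j)), 1:])"
    by (simp add: diag_mat_def o_def lessThan_atLeast0 flip: prod.list_conv_set_nth)
       (subst prod.distinct_set_conv_list[symmetric], auto)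
  also have "\<dots> = (\<Prod>j\<in>{t..<n}. [:- d (c j), 1:])"
    by (rule prod.reindex_bij_witness[of _ "\<lambda>j. j - t" "\<lambda>j. t + j"]) auto
  finally show ?thesis .
qed

lemma spectral_sum_twin_classes:
  fixes d :: "nat \<Rightarrow> real" and r :: "nat \<Rightarrow> nat \<Rightarrow> real" and c :: "nat \<Rightarrow> nat"
  assumes tn: "t \<le> n" and ct: "\<And>i. i < n \<Longrightarrow> c i < t" and rep: "\<And>s. s < t \<Longrightarrow> c s = s"
    and quotient: "char_poly (mat t t (\<lambda>(s, s'). (if s = s' then d s else 0)
        + real (card {i. i < n \<and> c i = s}) * r s s')) = (\<Prod>s<t. [:- e s, 1:])"
  shows "spectral_sum f (mat n n (\<lambda>(i, j). (if i = j then d (c i) else 0) + r (c i) (c j))) =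
    (\<Sum>s<t. f (e s)) + (\<Sum>s<t. (real (card {i. i < n \<and> c i = s}) - 1) * f (d s))"
proof -
  have split: "{..<n} = {..<t} \<union> {t..<n}" "{..<t} \<inter> {t..<n} = {}" using tn by auto
  have "char_poly (mat n n (\<lambda>(i, j). (if i = j then d (c i) else 0) + r (c i) (c j))) =
      (\<Prod>k<n. [:- (if k < t then e k else d (c k)), 1:])"
  proof -
    have "(\<Prod>k<n. [:- (if k < t then e k else d (c k)), 1:]) =
        (\<Prod>s<t. [:- e s, 1:]) * (\<Prod>j\<in>{t..<n}. [:- d (c j), 1:])"
      unfolding split(1) by (subst prod.union_disjoint) auto
    then show ?thesis
      using char_poly_twin_classes[where d = d and r = r, OF tn ct rep] quotient by simp
  qed
  from spectral_sum_linear_factors[OF this, of f]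
  have 1: "spectral_sum f (mat n n (\<lambda>(i, j). (if i = j then d (c i) else 0) + r (c i) (c j))) =
      (\<Sum>s<t. f (e s)) + (\<Sum>j\<in>{t..<n}. f (d (c j)))"
    unfolding split(1) by (subst (asm) sum.union_disjoint) auto
  have "(\<Sum>j<n. f (d (c j))) = (\<Sum>s<t. \<Sum>j | j \<in> {..<n} \<and> c j = s. f (d (c j)))"
    using ct by (subst sum.group[symmetric, of _ "{..<t}" c]) auto
  also have "\<dots> = (\<Sum>s<t. real (card {i. i < n \<and> c i = s}) * f (d s))"
    by (intro sum.cong refl) auto
  finally have "(\<Sum>j<n. f (d (c j))) = (\<Sum>s<t. real (card {i. i < n \<and> c i = s}) * f (d s))" .
  moreover have "(\<Sum>j<n. f (d (c j))) = (\<Sum>s<t. f (d s)) + (\<Sum>j\<in>{t..<n}. f (d (c j)))"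
    unfolding split(1) by (subst sum.union_disjoint) (auto simp: rep)
  ultimately show ?thesis
    unfolding 1 by (simp add: left_diff_distrib sum_subtractf)
qed

section \<open>The signless Laplacian and its power sums\<close>

text \<open>
  The signless Laplacian along an explicit enumeration of the vertices. A free choice of the enumeration
  makes it possible to compare two graphs on the same vertices, and to put representatives of vertex classes first.
\<close>
definition graph_matrix :: "'a list \<Rightarrow> ('a \<times> 'a) set \<Rightarrow> real mat" where
  "graph_matrix vs E = mat (length vs) (length vs) (\<lambda>(i, j).
     (if i = j then real (card {w. (vs ! i, w) \<in> E}) else 0) + (if (vs ! i, vs ! j) \<in> E then 1 else 0))"

lemma graph_matrix_carrier: "graph_matrix vs E \<in> carrier_mat (length vs) (length vs)"
  by (simp add: graph_matrix_def)

lemma vertex_list: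
  assumes "finite (pverts G)"
  shows "distinct (vertex_list G)" "set (vertex_list G) = pverts G"
    "length (vertex_list G) = card (pverts G)"
proof -
  obtain vs where "distinct vs \<and> set vs = pverts G"
    using finite_distinct_list[OF assms] by blast
  then have "distinct (vertex_list G) \<and> set (vertex_list G) = pverts G"
    unfolding vertex_list_def by (rule someI)
  then show "distinct (vertex_list G)" "set (vertex_list G) = pverts G"
    "length (vertex_list G) = card (pverts G)"
    by (auto simp: distinct_card[symmetric])
qed

lemma out_degree_with_proj: "out_degree (with_proj G) v = card {w. (v, w) \<in> parcs G}"
proof -
  have "out_arcs (with_proj G) v = Pair v ` {w. (v, w) \<in> parcs G}"
    by (auto simp: out_arcs_def)
  then show ?thesis by (simp add: out_degree_def card_image inj_on_def)
qed

lemma signless_laplacian_eq_graph_matrix: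
  assumes "finite (pverts G)"
  shows "signless_laplacian G = graph_matrix (vertex_list G) (parcs G)"
  by (rule eq_matI) (auto simp: signless_laplacian_def degree_matrix_def adjacency_matrix_def
      graph_matrix_def mat_diag_def out_degree_with_proj vertex_list[OF assms])

text \<open>
  The matrices of two enumerations are conjugate under the permutation matrix that relates them.
\<close>
lemma char_poly_graph_matrix_reorder:
  assumes vs: "distinct vs" and ws: "distinct ws" and eq: "set vs = set ws"
  shows "char_poly (graph_matrix vs E) = char_poly (graph_matrix ws E)"
proof -
  define n where "n = length vs"
  have lw: "length ws = n" using distinct_card[OF vs] distinct_card[OF ws] eq by (simp add: n_def)
  define P :: "real mat" where "P = mat n n (\<lambda>(i, j). if vs ! i = ws ! j then 1 else 0)"
  let ?V = "graph_matrix vs E" and ?W = "graph_matrix ws E"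
  have V: "?V \<in> carrier_mat n n" and W: "?W \<in> carrier_mat n n"
    using graph_matrix_carrier[of vs E] graph_matrix_carrier[of ws E] by (simp_all add: n_def lw[unfolded n_def])
  have P: "P \<in> carrier_mat n n" and tP: "transpose_mat P \<in> carrier_mat n n" by (auto simp: P_def)
  define \<pi> where "\<pi> i = (THE j. j < n \<and> ws ! j = vs ! i)" for i
  have \<pi>: "\<pi> i < n" "ws ! \<pi> i = vs ! i" if "i < n" for i
  proof -
    have "vs ! i \<in> set ws" using nth_mem[of i vs] that unfolding n_def eq .
    then have "\<exists>!j. j < n \<and> ws ! j = vs ! i"
      using distinct_Ex1[OF ws] lw by simp
    from theI'[OF this] show "\<pi> i < n" "ws ! \<pi> i = vs ! i" by (auto simp: \<pi>_def)
  qed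
  have Pe: "P $$ (i, j) = (if j = \<pi> i then 1 else 0)" if "i < n" "j < n" for i j
    using that \<pi>[OF that(1)] ws lw by (auto simp: P_def nth_eq_iff_index_eq)
  have PPt: "P * transpose_mat P = 1\<^sub>m n"
  proof (rule eq_matI)
    fix i j assume "i < dim_row (1\<^sub>m n :: real mat)" "j < dim_col (1\<^sub>m n :: real mat)"
    then have ij: "i < n" "j < n" by auto
    have "(P * transpose_mat P) $$ (i, j) = (\<Sum>l<n. P $$ (i, l) * transpose_mat P $$ (l, j))"
      by (rule index_mult_mat_sum[OF P tP ij])
    also have "\<dots> = (\<Sum>l<n. if l = \<pi> i then (if \<pi> i = \<pi> j then 1 else 0) else 0)"
      using ij P by (intro sum.cong refl) (auto simp: Pe)
    also have "\<pi> i = \<pi> j \<longleftrightarrow> vs ! i = vs ! j"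
      using \<pi>[OF ij(1)] \<pi>[OF ij(2)] ws lw by (metis nth_eq_iff_index_eq)
    also have "(\<Sum>l<n. if l = \<pi> i then (if vs ! i = vs ! j then 1 else 0) else 0) =
        (if vs ! i = vs ! j then 1 else (0 :: real))"
      using \<pi>(1)[OF ij(1)] by simp
    also have "\<dots> = 1\<^sub>m n $$ (i, j)"
      using ij vs by (auto simp: n_def nth_eq_iff_index_eq)
    finally show "(P * transpose_mat P) $$ (i, j) = 1\<^sub>m n $$ (i, j)" .
  qed (use P in auto)
  have PtP: "transpose_mat P * P = 1\<^sub>m n"
    by (rule mat_mult_left_right_inverse[OF P tP PPt])
  have PWe: "(P * ?W) $$ (i, j) = ?W $$ (\<pi> i, j)" if ij: "i < n" "j < n" for i j
  proof -
    have "(P * ?W) $$ (i, j) = (\<Sum>l<n. P $$ (i, l) * ?W $$ (l, j))"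
      by (rule index_mult_mat_sum[OF P W ij])
    also have "\<dots> = (\<Sum>l<n. if l = \<pi> i then ?W $$ (\<pi> i, j) else 0)"
      using ij by (intro sum.cong refl) (auto simp: Pe)
    finally show ?thesis using \<pi>[OF ij(1)] by simp
  qed
  have PW: "P * ?W \<in> carrier_mat n n" using P W by simp
  have "?V = P * ?W * transpose_mat P"
  proof (rule eq_matI)
    fix i j assume "i < dim_row (P * ?W * transpose_mat P)" "j < dim_col (P * ?W * transpose_mat P)"
    then have ij: "i < n" "j < n" using P by auto
    have "(P * ?W * transpose_mat P) $$ (i, j) = (\<Sum>l<n. (P * ?W) $$ (i, l) * transpose_mat P $$ (l, j))"
      by (rule index_mult_mat_sum[OF PW tP ij])
    also have "\<dots> = (\<Sum>l<n. if l = \<pi> j then ?W $$ (\<pi> i, \<pi> j) else 0)"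
      using ij P by (intro sum.cong refl) (auto simp: Pe PWe)
    also have "\<dots> = ?W $$ (\<pi> i, \<pi> j)" using \<pi>[OF ij(2)] by simp
    also have "\<dots> = ?V $$ (i, j)"
    proof -
      have "\<pi> i = \<pi> j \<longleftrightarrow> i = j"
        using \<pi>[OF ij(1)] \<pi>[OF ij(2)] vs ij by (metis n_def nth_eq_iff_index_eq)
      then show ?thesis
        using \<pi>[OF ij(1)] \<pi>[OF ij(2)] ij lw by (simp add: graph_matrix_def n_def)
    qed
    finally show "?V $$ (i, j) = (P * ?W * transpose_mat P) $$ (i, j)" by simp
  qed (use P V in auto)
  then have "similar_mat ?V ?W"
    by (intro similar_matI[OF _ PPt PtP]) (use V W P in simp_all)
  then show ?thesis by (rule char_poly_similar)
qed

lemma S_sum_eq_spectral_sum: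
  assumes "finite (pverts G)" "distinct vs" "set vs = pverts G"
  shows "S_sum \<alpha> G = spectral_sum (\<lambda>q. q powr \<alpha>) (graph_matrix vs (parcs G))"
proof -
  have "Q_spectrum G = proots (char_poly (graph_matrix vs (parcs G)))"
    using char_poly_graph_matrix_reorder[OF vertex_list(1)[OF assms(1)] assms(2), of "parcs G"]
    by (simp add: Q_spectrum_def signless_laplacian_eq_graph_matrix vertex_list assms)
  moreover have "(\<Sum>q \<in># filter_mset (\<lambda>q. q \<noteq> 0) X. q powr \<alpha>) = (\<Sum>q \<in># X. q powr \<alpha>)" for X :: "real multiset"
    by (induction X) auto
  ultimately show ?thesis by (simp add: S_sum_def spectral_sum_def)
qed

lemma sum_nth_distinct:
  assumes "distinct vs"
  shows "(\<Sum>i<length vs. g (vs ! i)) = (\<Sum>v\<in>set vs. g v)"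
  using assms by (simp add: sum.distinct_set_conv_list sum_list_sum_nth lessThan_atLeast0)

lemma card_neighbours_eq_sum:
  assumes "distinct vs" "E \<subseteq> set vs \<times> set vs"
  shows "real (card {w. (v, w) \<in> E}) = (\<Sum>j<length vs. if (v, vs ! j) \<in> E then 1 else 0)"
proof -
  have "{w. (v, w) \<in> E} = {w \<in> set vs. (v, w) \<in> E}" using assms(2) by auto
  then show ?thesis
    by (simp add: sum_nth_distinct[OF assms(1), of "\<lambda>w. if (v, w) \<in> E then 1 else 0"] sum.If_cases Int_def)
qed

text \<open>
  The form of the signless Laplacian is a sum of squares over the edges, the half being there because
  each edge occurs as two arcs. So the form is non-negative and grows when edges are added.
\<close>
lemma quad_form_graph_matrix:
  assumes vs: "distinct vs" and E: "E \<subseteq> set vs \<times> set vs" and sym: "sym E"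
  shows "quad_form (graph_matrix vs E) x =
    (\<Sum>i<length vs. \<Sum>j<length vs. if (vs ! i, vs ! j) \<in> E then (x i + x j)\<^sup>2 else 0) / 2"
proof -
  let ?n = "length vs"
  define e :: "nat \<Rightarrow> nat \<Rightarrow> real" where "e i j = (if (vs ! i, vs ! j) \<in> E then 1 else 0)" for i j
  have e_sym: "e i j = e j i" for i j using sym by (auto simp: e_def dest: symD)
  have deg: "real (card {w. (vs ! i, w) \<in> E}) = (\<Sum>j<?n. e i j)" for i
    unfolding e_def by (rule card_neighbours_eq_sum[OF vs E])
  have "quad_form (graph_matrix vs E) x =
      (\<Sum>i<?n. \<Sum>j<?n. (if j = i then (\<Sum>l<?n. e i l) * (x i)\<^sup>2 else 0) + e i j * x i * x j)"
    unfolding quad_form_def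
    by (intro sum.cong) (auto simp: graph_matrix_def deg e_def power2_eq_square algebra_simps)
  also have "\<dots> = (\<Sum>i<?n. \<Sum>j<?n. e i j * (x i)\<^sup>2) + (\<Sum>i<?n. \<Sum>j<?n. e i j * x i * x j)"
    by (simp add: sum.distrib sum_distrib_right)
  finally have 1: "quad_form (graph_matrix vs E) x = \<dots>" .
  have "(\<Sum>i<?n. \<Sum>j<?n. e i j * (x i)\<^sup>2) = (\<Sum>j<?n. \<Sum>i<?n. e j i * (x i)\<^sup>2)"
    by (subst sum.swap) (simp add: e_sym)
  then have 2: "(\<Sum>i<?n. \<Sum>j<?n. e i j * (x i)\<^sup>2) = (\<Sum>i<?n. \<Sum>j<?n. e i j * (x j)\<^sup>2)" .
  have "(\<Sum>i<?n. \<Sum>j<?n. if (vs ! i, vs ! j) \<in> E then (x i + x j)\<^sup>2 else 0) =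
      (\<Sum>i<?n. \<Sum>j<?n. e i j * (x i)\<^sup>2 + e i j * (x j)\<^sup>2 + 2 * (e i j * x i * x j))"
    by (intro sum.cong refl) (auto simp: e_def power2_eq_square algebra_simps)
  also have "\<dots> = 2 * ((\<Sum>i<?n. \<Sum>j<?n. e i j * (x i)\<^sup>2) + (\<Sum>i<?n. \<Sum>j<?n. e i j * x i * x j))"
    by (simp add: sum.distrib 2 flip: sum_distrib_left)
  finally show ?thesis unfolding 1 by simp
qed

lemma pair_graph_arcs:
  assumes "pair_graph G"
  shows "finite (pverts G)" "parcs G \<subseteq> pverts G \<times> pverts G" "sym (parcs G)" "(v, v) \<notin> parcs G"
proof -
  interpret pair_graph G by fact
  show "finite (pverts G)" by (rule pair_finite_verts)
  show "parcs G \<subseteq> pverts G \<times> pverts G"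
    using in_arcsD1 in_arcsD2 by (auto dest: arc_fst_in_verts arc_snd_in_verts)
  show "sym (parcs G)" using pair_sym_arcs by (simp add: symmetric_def)
  show "(v, v) \<notin> parcs G" using pair_no_loops[of "(v, v)"] by auto
qed

text \<open>
  Adding edges increases the form of the signless Laplacian weakly, and its trace, the sum of the degrees,
  strictly.
\<close>
lemma S_sum_strict_mono:
  assumes G: "pair_graph G" and H: "pair_graph H" and V: "pverts G = pverts H"
    and sub: "parcs G \<subset> parcs H" and \<alpha>: "1 \<le> \<alpha>"
  shows "S_sum \<alpha> G < S_sum \<alpha> H"
proof -
  note G = pair_graph_arcs[OF G] and H = pair_graph_arcs[OF H]
  obtain vs where vs: "distinct vs" "set vs = pverts G"
    using finite_distinct_list[OF G(1)] by blast
  let ?n = "length vs" and ?A = "graph_matrix vs (parcs G)" and ?B = "graph_matrix vs (parcs H)"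
  have qf: "quad_form (graph_matrix vs (parcs K)) x = (\<Sum>i<?n. \<Sum>j<?n.
      if (vs ! i, vs ! j) \<in> parcs K then (x i + x j)\<^sup>2 else 0) / 2" if "K = G \<or> K = H" for K x
    using that G H V vs by (intro quad_form_graph_matrix) auto
  have symm: "transpose_mat (graph_matrix vs (parcs K)) = graph_matrix vs (parcs K)" if "K = G \<or> K = H" for K
    using that G(3) H(3) by (intro eq_matI) (auto simp: graph_matrix_def dest: symD)
  have diag: "graph_matrix vs (parcs K) $$ (i, i) = card {w. (vs ! i, w) \<in> parcs K}"
    if "K = G \<or> K = H" "i < ?n" for K i
    using that G(4) H(4) by (auto simp: graph_matrix_def)
  have "spectral_sum (\<lambda>q. q powr \<alpha>) ?A < spectral_sum (\<lambda>q. q powr \<alpha>) ?B"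
  proof (rule spectral_sum_powr_strict_mono[where n = ?n])
    show "0 \<le> quad_form ?A x" for x by (auto simp: qf intro!: sum_nonneg)
    show "quad_form ?A x \<le> quad_form ?B x" for x
    proof -
      have "(\<Sum>i<?n. \<Sum>j<?n. if (vs ! i, vs ! j) \<in> parcs G then (x i + x j)\<^sup>2 else 0) \<le>
          (\<Sum>i<?n. \<Sum>j<?n. if (vs ! i, vs ! j) \<in> parcs H then (x i + x j)\<^sup>2 else 0)"
        by (intro sum_mono) (use sub in auto)
      then show ?thesis by (simp add: qf)
    qed
    have fin: "finite {w. (v, w) \<in> parcs H}" for v
      by (rule finite_subset[OF _ H(1)]) (use H(2) in auto)
    obtain u w where uw: "(u, w) \<in> parcs H" "(u, w) \<notin> parcs G" using sub by auto
    then have "u \<in> set vs" using H(2) V vs(2) by auto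
    then obtain i where i: "i < ?n" "vs ! i = u" by (auto simp: in_set_conv_nth)
    show "(\<Sum>i<?n. ?A $$ (i, i)) < (\<Sum>i<?n. ?B $$ (i, i))"
    proof (rule sum_strict_mono_ex1)
      show "\<forall>i\<in>{..<?n}. ?A $$ (i, i) \<le> ?B $$ (i, i)"
        using sub by (auto simp: diag intro!: card_mono[OF fin])
      have "card {w. (u, w) \<in> parcs G} < card {w. (u, w) \<in> parcs H}"
        using sub uw by (intro psubset_card_mono[OF fin]) auto
      then show "\<exists>i\<in>{..<?n}. ?A $$ (i, i) < ?B $$ (i, i)"
        using i by (intro bexI[of _ i]) (auto simp: diag)
    qed simp
  qed (use graph_matrix_carrier symm \<alpha> in auto)
  then show ?thesis
    using S_sum_eq_spectral_sum[OF G(1) vs] S_sum_eq_spectral_sum[OF H(1) vs(1)] vs V by simp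
qed

text \<open>
  Vertices of one class are adjacent twins, which have the same closed neighbourhood. The diagonal
  of the signless Laplacian holds the degree \<open>\<delta> + 1\<close>; one unit of it is regarded as part of the class-dependent
  matrix \<open>r\<close>, which therefore is \<open>1\<close> on its diagonal, and \<open>\<delta>\<close> is the eigenvalue of the class.
\<close>
lemma S_sum_twin_classes:
  fixes cl :: "'a \<Rightarrow> nat" and \<delta> :: "nat \<Rightarrow> real" and r :: "nat \<Rightarrow> nat \<Rightarrow> real"
  assumes G: "pair_graph G"
    and cl: "cl ` pverts G = {..<t}"
    and deg: "\<And>v. v \<in> pverts G \<Longrightarrow> real (card {w. (v, w) \<in> parcs G}) = \<delta> (cl v) + 1"
    and adj: "\<And>u v. u \<in> pverts G \<Longrightarrow> v \<in> pverts G \<Longrightarrow> u \<noteq> v \<Longrightarrow>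
      r (cl u) (cl v) = (if (u, v) \<in> parcs G then 1 else 0)"
    and twin: "\<And>s. s < t \<Longrightarrow> r s s = 1"
    and quotient: "char_poly (mat t t (\<lambda>(s, s'). (if s = s' then \<delta> s else 0)
        + real (card {v \<in> pverts G. cl v = s}) * r s s')) = (\<Prod>s<t. [:- e s, 1:])"
  shows "S_sum \<alpha> G =
    (\<Sum>s<t. e s powr \<alpha>) + (\<Sum>s<t. (real (card {v \<in> pverts G. cl v = s}) - 1) * \<delta> s powr \<alpha>)"
proof -
  note fin = pair_graph_arcs(1)[OF G] and loops = pair_graph_arcs(4)[OF G]
  have "\<exists>v. v \<in> pverts G \<and> cl v = s" if "s < t" for s
    using cl that by (metis imageE lessThan_iff)
  then obtain rep where rep: "rep s \<in> pverts G" "cl (rep s) = s" if "s < t" for s by metis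
  obtain ws where ws: "distinct ws" "set ws = pverts G - rep ` {..<t}"
    using finite_distinct_list[of "pverts G - rep ` {..<t}"] fin by blast
  define vs where "vs = map rep [0..<t] @ ws"
  have "inj_on rep {..<t}" by (rule inj_onI) (metis lessThan_iff rep(2))
  then have vs: "distinct vs" "set vs = pverts G"
    using ws rep by (auto simp: vs_def distinct_map lessThan_atLeast0)
  define c where "c i = cl (vs ! i)" for i
  have tn: "t \<le> length vs" by (simp add: vs_def)
  have ct: "c i < t" if "i < length vs" for i
    using that cl vs(2) nth_mem[OF that] by (auto simp: c_def)
  have rep': "c s = s" if "s < t" for s
    using that rep by (simp add: c_def vs_def nth_append)
  have class_card: "card {i. i < length vs \<and> c i = s} = card {v \<in> pverts G. cl v = s}" for s
  proof -
    have "{v \<in> pverts G. cl v = s} = (!) vs ` {i. i < length vs \<and> c i = s}"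
      unfolding vs(2)[symmetric] by (auto simp: c_def in_set_conv_nth)
    moreover have "inj_on ((!) vs) {i. i < length vs \<and> c i = s}"
      using vs(1) by (auto simp: inj_on_def nth_eq_iff_index_eq)
    ultimately show ?thesis by (simp add: card_image)
  qed
  have "graph_matrix vs (parcs G) =
      mat (length vs) (length vs) (\<lambda>(i, j). (if i = j then \<delta> (c i) else 0) + r (c i) (c j))"
  proof (rule eq_matI)
    fix i j
    assume "i < dim_row (mat (length vs) (length vs) (\<lambda>(i, j). (if i = j then \<delta> (c i) else 0) + r (c i) (c j)))"
      "j < dim_col (mat (length vs) (length vs) (\<lambda>(i, j). (if i = j then \<delta> (c i) else 0) + r (c i) (c j)))"
    then have ij: "i < length vs" "j < length vs" by auto
    then have in_V: "vs ! i \<in> pverts G" "vs ! j \<in> pverts G" using nth_mem[OF ij(1)] nth_mem[OF ij(2)] vs(2) by simp_all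
    have "vs ! i = vs ! j \<longleftrightarrow> i = j" using vs(1) ij by (simp add: nth_eq_iff_index_eq)
    then show "graph_matrix vs (parcs G) $$ (i, j) =
      mat (length vs) (length vs) (\<lambda>(i, j). (if i = j then \<delta> (c i) else 0) + r (c i) (c j)) $$ (i, j)"
      using ij adj[OF in_V] deg[OF in_V(1)] twin[OF ct[OF ij(1)]] loops
      by (auto simp: graph_matrix_def c_def)
  qed (auto simp: graph_matrix_def)
  then show ?thesis
    using spectral_sum_twin_classes[where d = \<delta> and r = r and c = c and e = e, OF tn ct rep']
      S_sum_eq_spectral_sum[OF fin vs, of \<alpha>] quotient
    by (simp add: class_card)
qed

section \<open>Joins of a clique with two disjoint cliques\<close>

text \<open>
  The graph \<open>K\<^sub>s \<or> (K\<^sub>a \<union> K\<^sub>b)\<close> on its actual vertex sets, with \<open>s\<close>, \<open>a\<close>, \<open>b\<close> the sizes of \<open>S\<close>, \<open>A\<close>, \<open>B\<close>. The sets may be empty,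
  so that complete graphs are included.
\<close>
definition joined_cliques :: "'a pair_pre_digraph \<Rightarrow> 'a set \<Rightarrow> 'a set \<Rightarrow> 'a set \<Rightarrow> bool" where
  "joined_cliques G S A B \<longleftrightarrow>
     pverts G = S \<union> A \<union> B \<and> S \<inter> A = {} \<and> S \<inter> B = {} \<and> A \<inter> B = {} \<and>
     parcs G = {(u, v). u \<in> pverts G \<and> v \<in> pverts G \<and> u \<noteq> v \<and> \<not> (u \<in> A \<and> v \<in> B) \<and> \<not> (u \<in> B \<and> v \<in> A)}"

lemma S_sum_complete:
  assumes G: "pair_graph G" and ne: "pverts G \<noteq> {}"
    and arcs: "parcs G = {(u, v). u \<in> pverts G \<and> v \<in> pverts G \<and> u \<noteq> v}"
  shows "S_sum \<alpha> G = (real (card (pverts G)) - 1) * (real (card (pverts G)) - 2) powr \<alpha>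
    + (2 * real (card (pverts G)) - 2) powr \<alpha>"
proof -
  note fin = pair_graph_arcs(1)[OF G]
  let ?n = "real (card (pverts G))"
  have card: "card (pverts G) \<ge> 1" using ne fin by (simp add: Suc_le_eq card_gt_0_iff)
  have "S_sum \<alpha> G = (\<Sum>s<1::nat. (2 * ?n - 2) powr \<alpha>)
      + (\<Sum>s<1::nat. (real (card {v \<in> pverts G. 0 = s}) - 1) * (?n - 2) powr \<alpha>)"
  proof (rule S_sum_twin_classes[where cl = "\<lambda>_. 0" and \<delta> = "\<lambda>_. ?n - 2" and r = "\<lambda>_ _. 1" and
        t = 1 and e = "\<lambda>_. 2 * ?n - 2"])
    fix v assume v: "v \<in> pverts G"
    then have "{w. (v, w) \<in> parcs G} = pverts G - {v}" by (auto simp: arcs)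
    then show "real (card {w. (v, w) \<in> parcs G}) = ?n - 2 + 1"
      using v fin card by (simp add: of_nat_diff)
  next
    show "char_poly (mat 1 1 (\<lambda>(s, s'). (if s = s' then ?n - 2 else 0)
        + real (card {v \<in> pverts G. 0 = s}) * 1)) = (\<Prod>s<1::nat. [:- (2 * ?n - 2), 1:])"
      by (simp add: char_poly_def char_poly_matrix_def det_single)
  qed (use G ne arcs in auto)
  then show ?thesis by simp
qed

text \<open>
  The three cliques are classes of adjacent twins. The \<open>3 \<times> 3\<close> quotient matrix has the eigenvalue \<open>n - 2\<close> once
  more, and the other two eigenvalues have the sum \<open>2n + k - 4\<close>, independent of how the \<open>n - k\<close> vertices
  are divided between \<open>A\<close> and \<open>B\<close>.
\<close>
lemma S_sum_joined_cliques:
  fixes G :: "'a pair_pre_digraph"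
  assumes G: "pair_graph G" and J: "joined_cliques G S A B"
    and ne: "S \<noteq> {}" "A \<noteq> {}" "B \<noteq> {}"
  defines "k \<equiv> real (card S)" and "a \<equiv> real (card A)" and "b \<equiv> real (card B)"
    and "n \<equiv> real (card (pverts G))"
  shows "n = k + a + b" and "S_sum \<alpha> G = k * (n - 2) powr \<alpha>
      + (a - 1) * (k + a - 2) powr \<alpha> + (b - 1) * (k + b - 2) powr \<alpha>
      + (n - 2 + k / 2 + sqrt ((k - 2 * n)\<^sup>2 - 16 * (a * b)) / 2) powr \<alpha>
      + (n - 2 + k / 2 - sqrt ((k - 2 * n)\<^sup>2 - 16 * (a * b)) / 2) powr \<alpha>"
proof -
  have V: "pverts G = S \<union> A \<union> B" and disj: "S \<inter> A = {}" "S \<inter> B = {}" "A \<inter> B = {}"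
    and arcs: "parcs G = {(u, v). u \<in> pverts G \<and> v \<in> pverts G \<and> u \<noteq> v \<and>
      \<not> (u \<in> A \<and> v \<in> B) \<and> \<not> (u \<in> B \<and> v \<in> A)}"
    using J unfolding joined_cliques_def by blast+
  have fin: "finite S" "finite A" "finite B" using pair_graph_arcs(1)[OF G] V by auto
  have "card (pverts G) = card S + card A + card B"
    unfolding V using fin disj by (subst card_Un_disjoint; auto simp: card_Un_disjoint)+
  then show n: "n = k + a + b" by (simp add: n_def k_def a_def b_def)
  have pos: "1 \<le> card S" "1 \<le> card A" "1 \<le> card B"
    using ne fin by (auto simp: Suc_le_eq card_gt_0_iff)
  have pos': "1 \<le> k" "1 \<le> a" "1 \<le> b" using pos by (auto simp: k_def a_def b_def)
  define cl :: "'a \<Rightarrow> nat" where "cl v = (if v \<in> S then 0 else if v \<in> A then 1 else 2)" for v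
  define \<delta> :: "nat \<Rightarrow> real" where
    "\<delta> s = (if s = 0 then n - 2 else if s = 1 then k + a - 2 else k + b - 2)" for s
  define r :: "nat \<Rightarrow> nat \<Rightarrow> real" where
    "r s s' = (if (s = 1 \<and> s' = 2) \<or> (s = 2 \<and> s' = 1) then 0 else 1)" for s s'
  define m where "m = n - 2 + k / 2"
  define h where "h = sqrt ((k - 2 * n)\<^sup>2 - 16 * (a * b)) / 2"
  define e :: "nat \<Rightarrow> real" where
    "e s = (if s = 0 then n - 2 else if s = 1 then m + h else m - h)" for s
  have three: "{..<3} = {0, 1, 2 :: nat}" by auto
  have classes: "{v \<in> pverts G. cl v = 0} = S" "{v \<in> pverts G. cl v = 1} = A" "{v \<in> pverts G. cl v = 2} = B"
    using disj by (auto simp: V cl_def)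
  \<comment> \<open>The discriminant is non-negative by the inequality of the means for \<open>a\<close> and \<open>b\<close>.\<close>
  have "0 \<le> k * (k + 4 * (a + b)) + 4 * (a - b)\<^sup>2" using pos' by simp
  then have "0 \<le> (k - 2 * n)\<^sup>2 - 16 * (a * b)" by (simp add: n power2_eq_square algebra_simps)
  then have hh: "h\<^sup>2 = ((k - 2 * n)\<^sup>2 - 16 * (a * b)) / 4" by (simp add: h_def power_divide)
  let ?R = "mat 3 3 (\<lambda>(s, s'). (if s = s' then \<delta> s else 0)
        + real (card {v \<in> pverts G. cl v = s}) * r s s')"
  have quotient: "char_poly ?R = (\<Prod>s<3. [:- e s, 1:])"
  proof (rule poly_eq_poly_eq_iff[THEN iffD1], rule ext)
    fix x
    have R: "?R \<in> carrier_mat 3 3" by simp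
    have "poly (char_poly ?R) x = det (- (char_matrix ?R x))" by (rule char_poly_matrix[OF R])
    also have "\<dots> = (x - (n - 2) - k) * ((x - (k + a - 2) - a) * (x - (k + b - 2) - b))
        + k * (- a * (x - (k + b - 2) - b)) - k * ((x - (k + a - 2) - a) * b)"
      by (subst det_3) (simp_all add: char_matrix_def classes classes[unfolded One_nat_def] \<delta>_def r_def
          a_def[symmetric] b_def[symmetric] k_def[symmetric] algebra_simps)
    also have "\<dots> = (x - (n - 2)) * ((x - m)\<^sup>2 - h\<^sup>2)"
      unfolding hh m_def n by (simp add: field_simps power2_eq_square)
    also have "\<dots> = poly (\<Prod>s<3. [:- e s, 1:]) x"
      by (simp add: three e_def power2_eq_square algebra_simps)
    finally show "poly (char_poly ?R) x = poly (\<Prod>s<3. [:- e s, 1:]) x" .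
  qed
  have "S_sum \<alpha> G = (\<Sum>s<3. e s powr \<alpha>)
      + (\<Sum>s<3. (real (card {v \<in> pverts G. cl v = s}) - 1) * \<delta> s powr \<alpha>)"
  proof (rule S_sum_twin_classes[OF G _ _ _ _ quotient])
    show "cl ` pverts G = {..<3}"
      unfolding three using ne disj by (auto simp: V cl_def image_iff split: if_splits)
    show "real (card {w. (v, w) \<in> parcs G}) = \<delta> (cl v) + 1" if v: "v \<in> pverts G" for v
    proof -
      consider "v \<in> S" | "v \<in> A" | "v \<in> B" using v V by auto
      then show ?thesis
      proof cases
        case 1
        then have "{w. (v, w) \<in> parcs G} = pverts G - {v}" using disj v by (auto simp: arcs)
        then show ?thesis
          using 1 v fin V pos by (simp add: \<delta>_def cl_def n_def of_nat_diff card_gt_0_iff Suc_le_eq)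
      next
        case 2
        then have "{w. (v, w) \<in> parcs G} = S \<union> A - {v}" using disj by (auto simp: arcs V)
        then show ?thesis
          using 2 fin disj pos
          by (auto simp: \<delta>_def cl_def card_Un_disjoint k_def a_def of_nat_diff)
      next
        case 3
        then have "{w. (v, w) \<in> parcs G} = S \<union> B - {v}" using disj by (auto simp: arcs V)
        then show ?thesis
          using 3 fin disj pos
          by (auto simp: \<delta>_def cl_def card_Un_disjoint k_def b_def of_nat_diff)
      qed
    qed
    show "r (cl u) (cl v) = (if (u, v) \<in> parcs G then 1 else 0)"
      if "u \<in> pverts G" "v \<in> pverts G" "u \<noteq> v" for u v
      using that disj by (auto simp: arcs V r_def cl_def)
    show "r s s = 1" if "s < 3" for s by (auto simp: r_def)
  qed
  then show "S_sum \<alpha> G = k * (n - 2) powr \<alpha>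
      + (a - 1) * (k + a - 2) powr \<alpha> + (b - 1) * (k + b - 2) powr \<alpha>
      + (n - 2 + k / 2 + sqrt ((k - 2 * n)\<^sup>2 - 16 * (a * b)) / 2) powr \<alpha>
      + (n - 2 + k / 2 - sqrt ((k - 2 * n)\<^sup>2 - 16 * (a * b)) / 2) powr \<alpha>"
    unfolding three m_def[symmetric] h_def[symmetric]
    by (simp add: classes classes[unfolded One_nat_def] e_def \<delta>_def k_def[symmetric] a_def[symmetric]
        b_def[symmetric] algebra_simps)
qed

text \<open>
  The right-hand side is the left-hand side for the sizes \<open>1\<close> and \<open>a + b - 1\<close>. This is the part of the comparison
  that is strict for every exponent, including \<open>\<alpha> = 1\<close>.
  Both bases on the left are at most \<open>k + a + b - 3\<close>, and the first is smaller if \<open>b > 1\<close>.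
\<close>
lemma clique_sizes_unbalanced:
  fixes \<alpha> k a b :: real
  assumes \<alpha>: "1 \<le> \<alpha>" and k: "1 \<le> k" and a: "1 \<le> a" and b: "1 \<le> b"
  shows "(a - 1) * (k + a - 2) powr \<alpha> + (b - 1) * (k + b - 2) powr \<alpha> \<le> (a + b - 2) * (k + a + b - 3) powr \<alpha>"
    and "1 < a \<Longrightarrow> 1 < b \<Longrightarrow>
      (a - 1) * (k + a - 2) powr \<alpha> + (b - 1) * (k + b - 2) powr \<alpha> < (a + b - 2) * (k + a + b - 3) powr \<alpha>"
proof -
  let ?c = "(k + a + b - 3) powr \<alpha>"
  have split: "(a + b - 2) * ?c = (a - 1) * ?c + (b - 1) * ?c" by (simp add: algebra_simps)
  have A: "(a - 1) * (k + a - 2) powr \<alpha> \<le> (a - 1) * ?c"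
    and B: "(b - 1) * (k + b - 2) powr \<alpha> \<le> (b - 1) * ?c"
    using assms by (intro mult_left_mono powr_mono2; simp)+
  from A B split show "(a - 1) * (k + a - 2) powr \<alpha> + (b - 1) * (k + b - 2) powr \<alpha> \<le> (a + b - 2) * ?c"
    by linarith
  assume "1 < a" "1 < b"
  then have "(a - 1) * (k + a - 2) powr \<alpha> < (a - 1) * ?c"
    using assms by (intro mult_strict_left_mono powr_less_mono2) auto
  with B split show "(a - 1) * (k + a - 2) powr \<alpha> + (b - 1) * (k + b - 2) powr \<alpha> < (a + b - 2) * ?c"
    by linarith
qed

text \<open>
  The same comparison for the two eigenvalues of the quotient that depend on the sizes. Their sum is fixed and
  \<open>a * b \<ge> 1 * (a + b - 1)\<close>, so they lie furthest apart for the sizes \<open>1\<close> and \<open>a + b - 1\<close>. The smaller one is still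
  non-negative there, as the product of the two is \<open>2k(n - 3)\<close>.
\<close>
lemma quotient_eigenvalues_unbalanced:
  fixes \<alpha> k a b n :: real
  assumes \<alpha>: "1 \<le> \<alpha>" and k: "1 \<le> k" and a: "1 \<le> a" and b: "1 \<le> b" and n: "n = k + a + b"
  defines "m \<equiv> n - 2 + k / 2" and "h \<equiv> (\<lambda>q. sqrt ((k - 2 * n)\<^sup>2 - 16 * q) / 2)"
  shows "(m + h (a * b)) powr \<alpha> + (m - h (a * b)) powr \<alpha>
    \<le> (m + h (a + b - 1)) powr \<alpha> + (m - h (a + b - 1)) powr \<alpha>"
proof (rule powr_sum_spread[OF \<alpha>])
  have "0 \<le> (a - 1) * (b - 1)" using a b by simp
  then have ab: "a + b - 1 \<le> a * b" by (simp add: algebra_simps)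
  then have "h (a * b) \<le> h (a + b - 1)" by (simp add: h_def)
  then show "m - h (a + b - 1) \<le> m - h (a * b)" by simp
  have "0 \<le> k * (k + 4 * (a + b)) + 4 * (a - b)\<^sup>2" using k a b by simp
  then have "0 \<le> (k - 2 * n)\<^sup>2 - 16 * (a * b)" by (simp add: n power2_eq_square algebra_simps)
  then show "m - h (a * b) \<le> m + h (a * b)" by (simp add: h_def)
  have m: "0 \<le> 2 * m" using k a b by (simp add: m_def n)
  have "0 \<le> 8 * (k * (n - 3))" using k a b by (simp add: n)
  then have "(k - 2 * n)\<^sup>2 - 16 * (a + b - 1) \<le> (2 * m)\<^sup>2"
    by (simp add: m_def n power2_eq_square algebra_simps)
  then have "sqrt ((k - 2 * n)\<^sup>2 - 16 * (a + b - 1)) \<le> 2 * m"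
    using m by (metis real_sqrt_le_mono real_sqrt_unique)
  then show "0 \<le> m - h (a + b - 1)" by (simp add: h_def)
qed simp

lemma S_sum_joined_cliques_le_b_bound:
  assumes G: "pair_graph G" and J: "joined_cliques G S A B"
    and ne: "S \<noteq> {}" "A \<noteq> {}" "B \<noteq> {}" and \<alpha>: "1 \<le> \<alpha>"
  shows "S_sum \<alpha> G \<le> b_bound \<alpha> (card (pverts G)) (card S)"
    and "S_sum \<alpha> G = b_bound \<alpha> (card (pverts G)) (card S) \<longleftrightarrow> card A = 1 \<or> card B = 1"
proof -
  let ?k = "real (card S)" and ?a = "real (card A)" and ?b = "real (card B)"
    and ?n = "real (card (pverts G))"
  define h where "h q = sqrt ((?k - 2 * ?n)\<^sup>2 - 16 * q) / 2" for q
  define m where "m = ?n - 2 + ?k / 2"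
  note S = S_sum_joined_cliques[OF G J ne]
  have fin: "finite S" "finite A" "finite B"
    using pair_graph_arcs(1)[OF G] J by (auto simp: joined_cliques_def)
  have pos: "1 \<le> ?k" "1 \<le> ?a" "1 \<le> ?b"
    using ne fin by (auto simp: Suc_le_eq card_gt_0_iff)
  have eqn: "?n - ?k - 2 = ?a + ?b - 2" "?n - 3 = ?k + ?a + ?b - 3"
    "(?k - 2 * ?n)\<^sup>2 + 16 * (?k - ?n + 1) = (?k - 2 * ?n)\<^sup>2 - 16 * (?a + ?b - 1)"
    using S(1) by auto
  have b: "b_bound \<alpha> (card (pverts G)) (card S) = ?k * (?n - 2) powr \<alpha>
      + (?a + ?b - 2) * (?k + ?a + ?b - 3) powr \<alpha>
      + ((m + h (?a + ?b - 1)) powr \<alpha> + (m - h (?a + ?b - 1)) powr \<alpha>)"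
    unfolding b_bound_def eqn h_def m_def by simp
  have s: "S_sum \<alpha> G = ?k * (?n - 2) powr \<alpha>
      + ((?a - 1) * (?k + ?a - 2) powr \<alpha> + (?b - 1) * (?k + ?b - 2) powr \<alpha>)
      + ((m + h (?a * ?b)) powr \<alpha> + (m - h (?a * ?b)) powr \<alpha>)"
    unfolding S(2) h_def m_def by simp
  note c = clique_sizes_unbalanced[OF \<alpha> pos]
  note q = quotient_eigenvalues_unbalanced[OF \<alpha> pos S(1), folded m_def h_def]
  show "S_sum \<alpha> G \<le> b_bound \<alpha> (card (pverts G)) (card S)"
    unfolding s b using c(1) q by linarith
  show "S_sum \<alpha> G = b_bound \<alpha> (card (pverts G)) (card S) \<longleftrightarrow> card A = 1 \<or> card B = 1"
  proof
    assume eq: "S_sum \<alpha> G = b_bound \<alpha> (card (pverts G)) (card S)"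
    show "card A = 1 \<or> card B = 1"
    proof (rule ccontr)
      assume "\<not> ?thesis"
      then have "1 < ?a" "1 < ?b" using pos by auto
      from c(2)[OF this] q eq show False unfolding s b by linarith
    qed
  next
    assume "card A = 1 \<or> card B = 1"
    then show "S_sum \<alpha> G = b_bound \<alpha> (card (pverts G)) (card S)"
      unfolding s b by (auto simp: algebra_simps)
  qed
qed

section \<open>Separators\<close>

lemma parcs_mk_symmetric_induced:
  assumes "sym (parcs G)"
  shows "parcs (mk_symmetric (with_proj G \<restriction> W)) = {(u, v) \<in> parcs G. u \<in> W \<and> v \<in> W}"
  using assms by (auto simp: parcs_mk_symmetric dest: symD)

lemma not_connected_induced_iff:
  assumes sym: "sym (parcs G)" and W: "W \<noteq> {}"
  shows "\<not> Digraph_Component.connected (with_proj G \<restriction> W) \<longleftrightarrow>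
    (\<exists>A B. W = A \<union> B \<and> A \<inter> B = {} \<and> A \<noteq> {} \<and> B \<noteq> {} \<and> parcs G \<inter> A \<times> B = {})"
proof -
  define E where "E = {(u, v) \<in> parcs G. u \<in> W \<and> v \<in> W}"
  have conn: "Digraph_Component.connected (with_proj G \<restriction> W) \<longleftrightarrow>
      (\<forall>u\<in>W. \<forall>v\<in>W. (u, v) \<in> rtrancl_on W E)"
    using W unfolding connected_def strongly_connected_def reachable_def
    by (simp add: parcs_mk_symmetric_induced[OF sym] E_def)
  show ?thesis
  proof
    assume "\<not> Digraph_Component.connected (with_proj G \<restriction> W)"
    then obtain u v where uv: "u \<in> W" "v \<in> W" "(u, v) \<notin> rtrancl_on W E" unfolding conn by blast
    define A where "A = {w \<in> W. (u, w) \<in> rtrancl_on W E}"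
    have "W = A \<union> (W - A)" "A \<inter> (W - A) = {}" "u \<in> A" "v \<in> W - A"
      using uv by (auto simp: A_def)
    moreover have "parcs G \<inter> A \<times> (W - A) = {}"
    proof (rule ccontr)
      assume "\<not> ?thesis"
      then obtain x y where xy: "(x, y) \<in> parcs G" "x \<in> A" "y \<in> W" "y \<notin> A" by blast
      then have "(u, x) \<in> rtrancl_on W E" "(x, y) \<in> E" by (simp_all add: A_def E_def)
      then have "(u, y) \<in> rtrancl_on W E" using xy(3) by (rule rtrancl_on_into_rtrancl_on)
      with xy show False by (simp add: A_def)
    qed
    ultimately show "\<exists>A B. W = A \<union> B \<and> A \<inter> B = {} \<and> A \<noteq> {} \<and> B \<noteq> {} \<and> parcs G \<inter> A \<times> B = {}"
      by (metis empty_iff)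
  next
    assume "\<exists>A B. W = A \<union> B \<and> A \<inter> B = {} \<and> A \<noteq> {} \<and> B \<noteq> {} \<and> parcs G \<inter> A \<times> B = {}"
    then obtain A B u v where AB: "W = A \<union> B" "A \<inter> B = {}" "u \<in> A" "v \<in> B" "parcs G \<inter> A \<times> B = {}"
      by blast
    have "w \<in> A" if "(u, w) \<in> rtrancl_on W E" for w
      using that by (induction rule: rtrancl_on_induct) (use AB in \<open>auto simp: E_def\<close>)
    then show "\<not> Digraph_Component.connected (with_proj G \<restriction> W)"
      unfolding conn using AB by blast
  qed
qed

text \<open>
  Having two vertices to spare, \<open>G\<close> is not complete, since the connectivity of a complete graph is one less
  than its number of vertices. The complement of two non-adjacent vertices is then a disconnecting set, hence the
  minimum that defines the connectivity is attained.
\<close>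
lemma small_separator:
  assumes G: "pair_graph G" and conn: "vertex_connectivity G \<le> k" and k: "k + 2 \<le> card (pverts G)"
  obtains S A B where "pverts G = S \<union> A \<union> B" "S \<inter> A = {}" "S \<inter> B = {}" "A \<inter> B = {}"
    "card S = k" "A \<noteq> {}" "B \<noteq> {}" "parcs G \<inter> (A \<times> B \<union> B \<times> A) = {}"
proof -
  note fin = pair_graph_arcs(1)[OF G] and sub = pair_graph_arcs(2)[OF G]
    and sym = pair_graph_arcs(3)[OF G] and loops = pair_graph_arcs(4)[OF G]
  have nc: "\<not> complete_digraph (card (pverts G)) (with_proj G)"
    using conn k by (auto simp: vertex_connectivity_def)
  have "\<exists>u v. u \<in> pverts G \<and> v \<in> pverts G \<and> u \<noteq> v \<and> (u, v) \<notin> parcs G"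
  proof (rule ccontr)
    assume "\<not> ?thesis"
    then have "parcs G = {(u, v). (u, v) \<in> pverts G \<times> pverts G \<and> u \<noteq> v}"
      using sub loops by auto
    with nc fin show False by (simp add: complete_digraph_pair_def)
  qed
  then obtain u v where uv: "u \<in> pverts G" "v \<in> pverts G" "u \<noteq> v" "(u, v) \<notin> parcs G" by blast
  have "disconnecting_set G (pverts G - {u, v})"
  proof -
    have "pverts G - (pverts G - {u, v}) = {u, v}" using uv by auto
    moreover have "\<not> Digraph_Component.connected (with_proj G \<restriction> {u, v})"
      unfolding not_connected_induced_iff[OF sym insert_not_empty]
      by (intro exI[of _ "{u}"] exI[of _ "{v}"]) (use uv in auto)
    ultimately show ?thesis by (simp add: disconnecting_set_def)
  qed
  then have "\<exists>S. disconnecting_set G S \<and> card S = vertex_connectivity G"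
    using nc unfolding vertex_connectivity_def
    by (simp only: if_False) (rule LeastI_ex, blast)
  then obtain T where T: "disconnecting_set G T" "card T \<le> k" using conn by auto
  then have TV: "T \<subseteq> pverts G" and W: "pverts G - T \<noteq> {}"
    and "\<not> Digraph_Component.connected (with_proj G \<restriction> (pverts G - T))"
    by (auto simp: disconnecting_set_def)
  then obtain A B where AB: "pverts G - T = A \<union> B" "A \<inter> B = {}" "A \<noteq> {}" "B \<noteq> {}" "parcs G \<inter> A \<times> B = {}"
    unfolding not_connected_induced_iff[OF sym W] by blast
  \<comment> \<open>Enlarge the separator to exactly \<open>k\<close> vertices, sparing one vertex on each side.\<close>
  obtain x y where xy: "x \<in> A" "y \<in> B" using AB by auto
  have xyV: "x \<in> pverts G" "y \<in> pverts G" "x \<noteq> y" "x \<notin> T" "y \<notin> T" using xy AB by auto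
  have "card (pverts G - {x, y}) = card (pverts G) - 2"
    using xyV fin by (simp add: card_Diff_subset)
  then have "k \<le> card (pverts G - {x, y})" using k by simp
  then obtain S where S: "T \<subseteq> S" "S \<subseteq> pverts G - {x, y}" "card S = k"
    using exists_subset_between[of T k "pverts G - {x, y}"] T(2) TV xyV fin by blast
  show thesis
  proof (rule that[of S "A - S" "B - S"])
    show "parcs G \<inter> ((A - S) \<times> (B - S) \<union> (B - S) \<times> (A - S)) = {}"
      using AB(5) symD[OF sym] by blast
  qed (use S AB xy in blast)+
qed

section \<open>Isomorphism with the extremal graph\<close>

text \<open>
  Both graphs have the projections as their tail and head functions, which forces the arc map of an isomorphism
  to act as the vertex map on both ends.
\<close>
lemma isomorphic_bijection:
  assumes "isomorphic G H"
  obtains \<phi> where "inj_on \<phi> (pverts G)" "pverts H = \<phi> ` pverts G"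
    "\<And>u v. u \<in> pverts G \<Longrightarrow> v \<in> pverts G \<Longrightarrow> (u, v) \<in> parcs G \<longleftrightarrow> (\<phi> u, \<phi> v) \<in> parcs H"
proof -
  obtain f where f: "pre_digraph.digraph_isomorphism (with_proj G) f"
    and H: "with_proj H = app_iso f (with_proj G)"
    using assms unfolding isomorphic_def digraph_iso_def by blast
  let ?\<phi> = "iso_verts f"
  have inj: "inj_on ?\<phi> (pverts G)" and wf: "wf_digraph (with_proj G)"
    and ends: "\<And>a. a \<in> parcs G \<Longrightarrow> ?\<phi> (fst a) = iso_tail f (iso_arcs f a) \<and> ?\<phi> (snd a) = iso_head f (iso_arcs f a)"
    using f unfolding pre_digraph.digraph_isomorphism_def by auto
  have V: "pverts H = ?\<phi> ` pverts G" and E: "parcs H = iso_arcs f ` parcs G"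
    and th: "fst = iso_tail f" "snd = iso_head f"
    using arg_cong[OF H, of verts] arg_cong[OF H, of arcs] arg_cong[OF H, of tail] arg_cong[OF H, of head]
    by simp_all
  have "iso_arcs f a = (?\<phi> (fst a), ?\<phi> (snd a))" if "a \<in> parcs G" for a
    using ends[OF that] th by (metis prod.collapse)
  then have E': "parcs H = (\<lambda>a. (?\<phi> (fst a), ?\<phi> (snd a))) ` parcs G" unfolding E by (auto intro: image_cong)
  have sub: "fst a \<in> pverts G" "snd a \<in> pverts G" if "a \<in> parcs G" for a
    using wf_digraph.tail_in_verts[OF wf, of a] wf_digraph.head_in_verts[OF wf, of a] that by auto
  show thesis
  proof (rule that[OF inj V])
    fix u v assume uv: "u \<in> pverts G" "v \<in> pverts G"
    show "(u, v) \<in> parcs G \<longleftrightarrow> (?\<phi> u, ?\<phi> v) \<in> parcs H"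
    proof
      assume "(u, v) \<in> parcs G"
      then show "(?\<phi> u, ?\<phi> v) \<in> parcs H" unfolding E' by (rule rev_image_eqI) simp
    next
      assume "(?\<phi> u, ?\<phi> v) \<in> parcs H"
      then obtain a where a: "a \<in> parcs G" "?\<phi> u = ?\<phi> (fst a)" "?\<phi> v = ?\<phi> (snd a)"
        unfolding E' by auto
      have "u = fst a" by (rule inj_onD[OF inj a(2) uv(1) sub(1)[OF a(1)]])
      moreover have "v = snd a" by (rule inj_onD[OF inj a(3) uv(2) sub(2)[OF a(1)]])
      ultimately show "(u, v) \<in> parcs G" using a(1) by simp
    qed
  qed
qed

lemma isomorphicI:
  assumes G: "pair_graph G" and inj: "inj_on \<phi> (pverts G)" and V: "pverts H = \<phi> ` pverts G"
    and E: "parcs H = (\<lambda>(u, v). (\<phi> u, \<phi> v)) ` parcs G"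
  shows "isomorphic G H"
proof -
  interpret pair_graph G by fact
  let ?f = "\<lparr>iso_verts = \<phi>, iso_arcs = \<lambda>(u, v). (\<phi> u, \<phi> v), iso_head = snd, iso_tail = fst\<rparr>"
  have "inj_on (\<lambda>(u, v). (\<phi> u, \<phi> v)) (parcs G)"
    using pair_graph_arcs(2)[OF G] by (auto intro!: inj_onI dest: inj_onD[OF inj])
  then have "pre_digraph.digraph_isomorphism (with_proj G) ?f"
    unfolding pre_digraph.digraph_isomorphism_def using inj wf_digraph by auto
  moreover have "with_proj H = app_iso ?f (with_proj G)"
    unfolding app_iso_def by (simp add: with_proj_def V E)
  ultimately show ?thesis unfolding isomorphic_def digraph_iso_def by blast
qed

lemma joined_cliques_extremal_graph:
  "joined_cliques (extremal_graph n k) (Inl ` {0..<k}) (Inr ` Inl ` {0..<1}) (Inr ` Inr ` {0..<n - k - 1})"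
  unfolding joined_cliques_def extremal_graph_def graph_join_def disjoint_union_def complete_graph_def
  by (auto simp: Plus_def image_iff)

lemma joined_cliques_pullback:
  assumes iso: "isomorphic G H" and J: "joined_cliques H S' A' B'"
    and sub: "parcs G \<subseteq> pverts G \<times> pverts G"
  obtains S A B where "joined_cliques G S A B" "card S = card S'" "card A = card A'" "card B = card B'"
proof -
  obtain \<phi> where \<phi>: "inj_on \<phi> (pverts G)" "pverts H = \<phi> ` pverts G"
    "\<And>u v. u \<in> pverts G \<Longrightarrow> v \<in> pverts G \<Longrightarrow> (u, v) \<in> parcs G \<longleftrightarrow> (\<phi> u, \<phi> v) \<in> parcs H"
    using isomorphic_bijection[OF iso] by blast
  let ?p = "\<lambda>X. {v \<in> pverts G. \<phi> v \<in> X}"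
  have card: "card (?p X) = card X" if "X \<subseteq> pverts H" for X
  proof -
    have "\<phi> ` ?p X = X" using that \<phi>(2) by auto
    moreover have "inj_on \<phi> (?p X)" using \<phi>(1) by (rule inj_on_subset) auto
    ultimately show ?thesis by (metis card_image)
  qed
  have VH: "pverts H = S' \<union> A' \<union> B'" and disj: "S' \<inter> A' = {}" "S' \<inter> B' = {}" "A' \<inter> B' = {}"
    and EH: "parcs H = {(u, v). u \<in> pverts H \<and> v \<in> pverts H \<and> u \<noteq> v \<and>
      \<not> (u \<in> A' \<and> v \<in> B') \<and> \<not> (u \<in> B' \<and> v \<in> A')}"
    using J unfolding joined_cliques_def by blast+
  have VG: "\<phi> v \<in> pverts H" if "v \<in> pverts G" for v using that \<phi>(2) by auto
  have "(u, v) \<in> parcs G \<longleftrightarrow> u \<in> pverts G \<and> v \<in> pverts G \<and> u \<noteq> v \<and>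
      \<not> (u \<in> ?p A' \<and> v \<in> ?p B') \<and> \<not> (u \<in> ?p B' \<and> v \<in> ?p A')" for u v
  proof (cases "u \<in> pverts G \<and> v \<in> pverts G")
    case True
    then have "\<phi> u = \<phi> v \<longleftrightarrow> u = v" using \<phi>(1) by (simp add: inj_on_eq_iff)
    with True show ?thesis using \<phi>(3)[of u v] VG[of u] VG[of v] unfolding EH by simp
  next
    case False
    then show ?thesis using sub by auto
  qed
  then have "parcs G = {(u, v). u \<in> pverts G \<and> v \<in> pverts G \<and> u \<noteq> v \<and>
      \<not> (u \<in> ?p A' \<and> v \<in> ?p B') \<and> \<not> (u \<in> ?p B' \<and> v \<in> ?p A')}" by auto
  moreover have "pverts G = ?p S' \<union> ?p A' \<union> ?p B'" using VG VH by blast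
  ultimately have "joined_cliques G (?p S') (?p A') (?p B')"
    unfolding joined_cliques_def using disj by blast
  then show thesis
    by (rule that) (use card VH in auto)
qed

lemma isomorphic_joined_cliques:
  assumes G: "pair_graph G" and JG: "joined_cliques G S A B" and JH: "joined_cliques H S' A' B'"
    and fin: "finite S'" "finite A'" "finite B'"
    and card: "card S = card S'" "card A = card A'" "card B = card B'"
  shows "isomorphic G H"
proof -
  have VG: "pverts G = S \<union> A \<union> B" and dG: "S \<inter> A = {}" "S \<inter> B = {}" "A \<inter> B = {}"
    and EG: "parcs G = {(u, v). u \<in> pverts G \<and> v \<in> pverts G \<and> u \<noteq> v \<and>
      \<not> (u \<in> A \<and> v \<in> B) \<and> \<not> (u \<in> B \<and> v \<in> A)}"
    using JG unfolding joined_cliques_def by blast+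
  have VH: "pverts H = S' \<union> A' \<union> B'" and dH: "S' \<inter> A' = {}" "S' \<inter> B' = {}" "A' \<inter> B' = {}"
    and EH: "parcs H = {(u, v). u \<in> pverts H \<and> v \<in> pverts H \<and> u \<noteq> v \<and>
      \<not> (u \<in> A' \<and> v \<in> B') \<and> \<not> (u \<in> B' \<and> v \<in> A')}"
    using JH unfolding joined_cliques_def by blast+
  have finG: "finite S" "finite A" "finite B" using pair_graph_arcs(1)[OF G] VG by auto
  obtain f where f: "bij_betw f S S'" using finite_same_card_bij[OF finG(1) fin(1) card(1)] by blast
  obtain g where g: "bij_betw g A A'" using finite_same_card_bij[OF finG(2) fin(2) card(2)] by blast
  obtain h where h: "bij_betw h B B'" using finite_same_card_bij[OF finG(3) fin(3) card(3)] by blast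
  define \<phi> where "\<phi> v = (if v \<in> S then f v else if v \<in> A then g v else h v)" for v
  have S: "bij_betw \<phi> S S'"
    using f by (subst bij_betw_cong[of S \<phi> f]) (auto simp: \<phi>_def)
  have A: "bij_betw \<phi> A A'"
    using g dG by (subst bij_betw_cong[of A \<phi> g]) (auto simp: \<phi>_def)
  have B: "bij_betw \<phi> B B'"
    using h dG by (subst bij_betw_cong[of B \<phi> h]) (auto simp: \<phi>_def)
  have bij: "bij_betw \<phi> (pverts G) (pverts H)"
    unfolding VG VH using S A B dH by (intro bij_betw_combine) auto
  have memA: "\<phi> v \<in> A' \<longleftrightarrow> v \<in> A" and memB: "\<phi> v \<in> B' \<longleftrightarrow> v \<in> B" if "v \<in> pverts G" for v
    using that S A B dG dH bij_betwE[OF S] bij_betwE[OF A] bij_betwE[OF B] unfolding VG by blast+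
  have inj: "inj_on \<phi> (pverts G)" and img: "pverts H = \<phi> ` pverts G"
    using bij by (auto simp: bij_betw_def)
  show ?thesis
  proof (rule isomorphicI[OF G inj img])
    show "parcs H = (\<lambda>(u, v). (\<phi> u, \<phi> v)) ` parcs G"
    proof (intro equalityI subsetI)
      fix e assume "e \<in> parcs H"
      then obtain u v where e: "e = (\<phi> u, \<phi> v)" "u \<in> pverts G" "v \<in> pverts G"
        unfolding EH img by auto
      with \<open>e \<in> parcs H\<close> have "(u, v) \<in> parcs G"
        unfolding EH EG by (auto simp: memA memB)
      then show "e \<in> (\<lambda>(u, v). (\<phi> u, \<phi> v)) ` parcs G" using e by force
    next
      fix e assume "e \<in> (\<lambda>(u, v). (\<phi> u, \<phi> v)) ` parcs G"
      then obtain u v where e: "e = (\<phi> u, \<phi> v)" "(u, v) \<in> parcs G" by auto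
      then have uv: "u \<in> pverts G" "v \<in> pverts G" "u \<noteq> v" "\<not> (u \<in> A \<and> v \<in> B)" "\<not> (u \<in> B \<and> v \<in> A)"
        unfolding EG by auto
      then have "\<phi> u \<noteq> \<phi> v" using inj by (auto dest: inj_onD)
      with uv show "e \<in> parcs H" unfolding EH e(1) by (auto simp: memA memB img)
    qed
  qed
qed

text \<open>
  This replaces the concrete extremal graph by a property of \<open>G\<close> itself, whose spectrum can then be computed on
  its own vertex set.
\<close>
lemma isomorphic_extremal_graph_iff:
  assumes G: "pair_graph G"
  shows "isomorphic G (extremal_graph n k) \<longleftrightarrow>
    (\<exists>S A B. joined_cliques G S A B \<and> card S = k \<and> card A = 1 \<and> card B = n - k - 1)"
proof -
  have cards: "card (Inl ` {0..<k} :: (nat + nat + nat) set) = k"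
    "card (Inr ` Inl ` {0..<1} :: (nat + nat + nat) set) = 1"
    "card (Inr ` Inr ` {0..<n - k - 1} :: (nat + nat + nat) set) = n - k - 1"
    by (simp_all add: card_image inj_on_def)
  show ?thesis
  proof
    assume "isomorphic G (extremal_graph n k)"
    from joined_cliques_pullback[OF this joined_cliques_extremal_graph pair_graph_arcs(2)[OF G]]
    show "\<exists>S A B. joined_cliques G S A B \<and> card S = k \<and> card A = 1 \<and> card B = n - k - 1"
      unfolding cards by metis
  next
    assume "\<exists>S A B. joined_cliques G S A B \<and> card S = k \<and> card A = 1 \<and> card B = n - k - 1"
    then obtain S A B where J: "joined_cliques G S A B" and c: "card S = k" "card A = 1" "card B = n - k - 1"
      by blast
    show "isomorphic G (extremal_graph n k)"
      by (rule isomorphic_joined_cliques[OF G J joined_cliques_extremal_graph]) (use c cards in simp_all)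
  qed
qed

section \<open>The bound and its equality case\<close>

lemma pair_graphI:
  assumes "finite (pverts G)" "parcs G \<subseteq> pverts G \<times> pverts G" "sym (parcs G)" "\<And>v. (v, v) \<notin> parcs G"
  shows "pair_graph G"
proof -
  have "finite (parcs G)" using assms by (meson finite_SigmaI finite_subset)
  then show ?thesis
    using assms by unfold_locales (auto simp: symmetric_def)
qed

lemma S_sum_le_complete:
  assumes G: "pair_graph G" and ne: "pverts G \<noteq> {}" and \<alpha>: "1 \<le> \<alpha>"
  defines "K \<equiv> {(u, v). u \<in> pverts G \<and> v \<in> pverts G \<and> u \<noteq> v}"
    and "s \<equiv> (real (card (pverts G)) - 1) * (real (card (pverts G)) - 2) powr \<alpha>
      + (2 * real (card (pverts G)) - 2) powr \<alpha>"
  shows "S_sum \<alpha> G \<le> s" and "S_sum \<alpha> G = s \<longleftrightarrow> parcs G = K"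
proof -
  note G' = pair_graph_arcs[OF G]
  let ?K = "\<lparr>pverts = pverts G, parcs = K\<rparr>"
  have K: "pair_graph ?K"
    by (rule pair_graphI) (use G' in \<open>auto simp: K_def sym_def\<close>)
  have sK: "S_sum \<alpha> H = s" if "pair_graph H" "pverts H = pverts G" "parcs H = K" for H :: "'a pair_pre_digraph"
    using S_sum_complete[of H \<alpha>] that ne by (simp add: K_def s_def)
  have "S_sum \<alpha> G < s" if "parcs G \<noteq> K"
  proof -
    have "parcs G \<subseteq> K" using G'(2,4) by (auto simp: K_def)
    with that have "S_sum \<alpha> G < S_sum \<alpha> ?K"
      by (intro S_sum_strict_mono[OF G K _ _ \<alpha>]) auto
    then show ?thesis using sK[OF K] by simp
  qed
  moreover have "S_sum \<alpha> G = s" if "parcs G = K" using sK[OF G refl that] .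
  ultimately show "S_sum \<alpha> G \<le> s" "S_sum \<alpha> G = s \<longleftrightarrow> parcs G = K" by fastforce+
qed

theorem theorem4p3:
  fixes G :: "'a pair_pre_digraph" and n k :: nat and \<alpha> :: real
  assumes "1 \<le> n" and "1 \<le> k" and "k \<le> n - 1"
    and "G \<in> connectivity_at_most n k"
    and "1 \<le> \<alpha>"
  shows "S_sum \<alpha> G \<le> b_bound \<alpha> n k \<and>
         (S_sum \<alpha> G = b_bound \<alpha> n k \<longleftrightarrow> isomorphic G (extremal_graph n k))"
proof -
  have G: "pair_graph G" and n: "card (pverts G) = n" and conn: "vertex_connectivity G \<le> k"
    using assms(4) by (auto simp: connectivity_at_most_def connected_graphs_def)
  note G' = pair_graph_arcs[OF G]
  have ne: "pverts G \<noteq> {}" using n assms(1) by auto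
  show ?thesis
  proof (cases "k = n - 1")
    case True
    have "isomorphic G (extremal_graph n k) \<longleftrightarrow>
      parcs G = {(u, v). u \<in> pverts G \<and> v \<in> pverts G \<and> u \<noteq> v}" (is "_ \<longleftrightarrow> _ = ?K")
      unfolding isomorphic_extremal_graph_iff[OF G]
    proof
      assume "\<exists>S A B. joined_cliques G S A B \<and> card S = k \<and> card A = 1 \<and> card B = n - k - 1"
      then obtain S A B where J: "joined_cliques G S A B" and "card B = n - k - 1" by blast
      moreover from this have "finite B" using G'(1) by (auto simp: joined_cliques_def)
      ultimately have "B = {}" using True by simp
      with J show "parcs G = ?K" by (auto simp: joined_cliques_def)
    next
      assume K: "parcs G = ?K"
      obtain v where v: "v \<in> pverts G" using ne by blast
      have "joined_cliques G (pverts G - {v}) {v} {}"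
        unfolding joined_cliques_def using v K by auto
      then show "\<exists>S A B. joined_cliques G S A B \<and> card S = k \<and> card A = 1 \<and> card B = n - k - 1"
        using v n True G'(1) by (intro exI[of _ "pverts G - {v}"] exI[of _ "{v}"] exI[of _ "{}"]) auto
    qed
    then show ?thesis
      using S_sum_le_complete[OF G ne assms(5)] b_bound_complete[OF assms(1), of \<alpha>] True by (simp add: n)
  next
    case False
    then have k: "k + 2 \<le> n" using assms(3) by simp
    obtain S A B where V: "pverts G = S \<union> A \<union> B" and disj: "S \<inter> A = {}" "S \<inter> B = {}" "A \<inter> B = {}"
      and S: "card S = k" and AB: "A \<noteq> {}" "B \<noteq> {}" and sep: "parcs G \<inter> (A \<times> B \<union> B \<times> A) = {}"
      using small_separator[OF G conn] k n by metis
    have Sne: "S \<noteq> {}" using S assms(2) by auto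
    \<comment> \<open>The largest graph on the vertices of \<open>G\<close> that has no edges between \<open>A\<close> and \<open>B\<close>.\<close>
    define H where "H = \<lparr>pverts = pverts G, parcs = {(u, v). u \<in> pverts G \<and> v \<in> pverts G \<and> u \<noteq> v \<and>
      \<not> (u \<in> A \<and> v \<in> B) \<and> \<not> (u \<in> B \<and> v \<in> A)}\<rparr>"
    have H: "pair_graph H"
      by (rule pair_graphI) (use G' in \<open>auto simp: H_def sym_def\<close>)
    have JH: "joined_cliques H S A B"
      unfolding joined_cliques_def using V disj by (simp add: H_def)
    have sub: "parcs G \<subseteq> parcs H"
      using G'(2,4) sep by (auto simp: H_def)
    have VH: "pverts H = pverts G" by (simp add: H_def)
    note bound = S_sum_joined_cliques_le_b_bound[OF H JH Sne AB assms(5), unfolded VH n S]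
    have strict: "S_sum \<alpha> G < S_sum \<alpha> H" if "parcs G \<noteq> parcs H"
      using that sub by (intro S_sum_strict_mono[OF G H _ _ assms(5)]) (auto simp: VH)
    have le: "S_sum \<alpha> G \<le> S_sum \<alpha> H"
    proof (cases "parcs G = parcs H")
      case True
      then have "G = H" using VH by simp
      then show ?thesis by simp
    qed (use strict in auto)
    have "isomorphic G (extremal_graph n k)" if eq: "S_sum \<alpha> G = b_bound \<alpha> n k"
    proof -
      have GH: "parcs G = parcs H" using strict bound(1) eq by fastforce
      then have J: "joined_cliques G S A B" using JH VH by (simp add: joined_cliques_def)
      have "G = H" using GH VH by simp
      then have one: "card A = 1 \<or> card B = 1" using bound(2) eq by simp
      have fin: "finite S" "finite A" "finite B" using G'(1) V by auto
      have "card (pverts G) = card S + card A + card B"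
        unfolding V using fin disj by (subst card_Un_disjoint; auto simp: card_Un_disjoint)+
      then have sizes: "n = k + card A + card B" by (simp add: n S)
      have J': "joined_cliques G S B A" using J by (auto simp: joined_cliques_def)
      from one show ?thesis
      proof
        assume "card A = 1"
        with J S sizes have "joined_cliques G S A B \<and> card S = k \<and> card A = 1 \<and> card B = n - k - 1" by simp
        then show ?thesis unfolding isomorphic_extremal_graph_iff[OF G] by blast
      next
        assume "card B = 1"
        with J' S sizes have "joined_cliques G S B A \<and> card S = k \<and> card B = 1 \<and> card A = n - k - 1" by simp
        then show ?thesis unfolding isomorphic_extremal_graph_iff[OF G] by blast
      qed
    qed
    moreover have "S_sum \<alpha> G = b_bound \<alpha> n k" if iso: "isomorphic G (extremal_graph n k)"
    proof -
      obtain S' A' B' where J: "joined_cliques G S' A' B'"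
        and c: "card S' = k" "card A' = 1" "card B' = n - k - 1"
        using iso unfolding isomorphic_extremal_graph_iff[OF G] by blast
      have "S' \<noteq> {}" "A' \<noteq> {}" "B' \<noteq> {}" using c k assms(2) by auto
      from S_sum_joined_cliques_le_b_bound(2)[OF G J this assms(5)] show ?thesis
        using c n by simp
    qed
    ultimately show ?thesis using le bound(1) by auto
  qed
qed

end
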